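(* Let $X$ be a Hausdorff P-space relative to ${\mathbb C}$. Then $R=C(X,\mathbb{C})$ is strongly regular. Hence, every finite extension of $R$ is strongly $\pi$-regular. In particular, $\mathbb{M}_{n}(R)$ is strongly $\pi$-regular for every positive integer $n$.
   Context: All rings are associative with identity. $C(X,\mathbb C)$ is the ring of all complex-valued continuous functions on $X$. A topological space $X$ is completely regular if whenever $F$ is a closed set and $x\notin F$ there is a continuous $f:X\to[0,1]$ with $f(x)=1$ and $f[F]=\{0\}$. A completely regular space $X$ is a P-space relative to $\mathbb C$ if every prime ideal of $C(X,\mathbb C)$ is maximal. A ring $S$ is strongly regular if for every $a\in S$ there is $b\in S$ with $a=a^2b$. An element $a$ of a ring $S$ is strongly $\pi$-regular if both chains $Sa\supseteq Sa^2\supseteq\cdots$ and $aS\supseteq a^2S\supseteq\cdots$ terminate; $S$ is strongly $\pi$-regular if every element of $S$ is. If $R$ is a subring of a ring $S$ with the same identity, $S$ is called a finite extension of $R$ if $S$, as an $R$-module, is generated by a finite set. *)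

theory Defs
  imports "HOL-Analysis.Analysis" "HOL-Algebra.Subrings"
begin

text \<open>Functions on \<open>topspace X\<close> are represented by their extensional representatives (value
  \<open>undefined\<close> off the space), so that equality in the ring is equality of functions on \<open>X\<close>.\<close>

definition C_ring :: "'a topology \<Rightarrow> ('a \<Rightarrow> complex) ring" where
  "C_ring X =
     \<lparr>carrier = {f \<in> extensional (topspace X). continuous_map X euclidean f},
      mult = (\<lambda>f g. \<lambda>x\<in>topspace X. f x * g x),
      one = (\<lambda>x\<in>topspace X. 1),
      zero = (\<lambda>x\<in>topspace X. 0),
      add = (\<lambda>f g. \<lambda>x\<in>topspace X. f x + g x)\<rparr>"

text \<open>The library predicate \<^const>\<open>completely_regular_space\<close> separates with \<open>f x = 0\<close> and \<open>f = 1\<close>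
  on the closed set; replacing \<open>f\<close> by \<open>1 - f\<close> gives the convention with the values exchanged.\<close>

definition P_space_rel_C :: "'a topology \<Rightarrow> bool" where
  "P_space_rel_C X \<longleftrightarrow>
     completely_regular_space X \<and>
     (\<forall>P. primeideal P (C_ring X) \<longrightarrow> maximalideal P (C_ring X))"

definition strongly_regular :: "('a, 'm) ring_scheme \<Rightarrow> bool" where
  "strongly_regular S \<longleftrightarrow>
     ring S \<and>
     (\<forall>a\<in>carrier S. \<exists>b\<in>carrier S. a = a [^]\<^bsub>S\<^esub> (2::nat) \<otimes>\<^bsub>S\<^esub> b)"

definition strongly_pi_regular_elem :: "('a, 'm) ring_scheme \<Rightarrow> 'a \<Rightarrow> bool" where
  "strongly_pi_regular_elem S a \<longleftrightarrow>
     (\<exists>m::nat. \<forall>k\<ge>m. {s \<otimes>\<^bsub>S\<^esub> a [^]\<^bsub>S\<^esub> k |s. s \<in> carrier S} = {s \<otimes>\<^bsub>S\<^esub> a [^]\<^bsub>S\<^esub> m |s. s \<in> carrier S}) \<and>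
     (\<exists>m::nat. \<forall>k\<ge>m. {a [^]\<^bsub>S\<^esub> k \<otimes>\<^bsub>S\<^esub> s |s. s \<in> carrier S} = {a [^]\<^bsub>S\<^esub> m \<otimes>\<^bsub>S\<^esub> s |s. s \<in> carrier S})"

definition strongly_pi_regular :: "('a, 'm) ring_scheme \<Rightarrow> bool" where
  "strongly_pi_regular S \<longleftrightarrow> ring S \<and> (\<forall>a\<in>carrier S. strongly_pi_regular_elem S a)"

text \<open>The subring \<open>K\<close> need not be central, so \<open>S\<close> is both a left and a right \<open>K\<close>-module; finite
  generation on either side is accepted.  \<^const>\<open>subring\<close> includes \<open>\<one>\<^bsub>S\<^esub> \<in> K\<close>.\<close>

definition finite_extension :: "'a set \<Rightarrow> ('a, 'm) ring_scheme \<Rightarrow> bool" where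
  "finite_extension K S \<longleftrightarrow>
     ring S \<and> subring K S \<and>
     (\<exists>G. finite G \<and> G \<subseteq> carrier S \<and>
        ((\<forall>s\<in>carrier S. \<exists>c\<in>G \<rightarrow> K. s = (\<Oplus>\<^bsub>S\<^esub>g\<in>G. c g \<otimes>\<^bsub>S\<^esub> g)) \<or>
         (\<forall>s\<in>carrier S. \<exists>c\<in>G \<rightarrow> K. s = (\<Oplus>\<^bsub>S\<^esub>g\<in>G. g \<otimes>\<^bsub>S\<^esub> c g))))"

definition matrix_ring :: "nat \<Rightarrow> ('a, 'm) ring_scheme \<Rightarrow> (nat \<times> nat \<Rightarrow> 'a) ring" where
  "matrix_ring n R =
     \<lparr>carrier = {..<n} \<times> {..<n} \<rightarrow>\<^sub>E carrier R,
      mult = (\<lambda>A B. \<lambda>(i, j)\<in>{..<n} \<times> {..<n}. \<Oplus>\<^bsub>R\<^esub>k\<in>{..<n}. A (i, k) \<otimes>\<^bsub>R\<^esub> B (k, j)),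
      one = (\<lambda>(i, j)\<in>{..<n} \<times> {..<n}. if i = j then \<one>\<^bsub>R\<^esub> else \<zero>\<^bsub>R\<^esub>),
      zero = (\<lambda>(i, j)\<in>{..<n} \<times> {..<n}. \<zero>\<^bsub>R\<^esub>),
      add = (\<lambda>A B. \<lambda>(i, j)\<in>{..<n} \<times> {..<n}. A (i, j) \<oplus>\<^bsub>R\<^esub> B (i, j))\<rparr>"

end

theory Submission
  imports Defs "HOL-Algebra.Ring_Divisibility"
begin

text \<open>
  The ring \<open>C(X)\<close> of a P-space is strongly regular because it is reduced and its primes are
  maximal. Given \<open>a\<close>, let \<open>T\<close> be the multiplicative set of the elements \<open>a^k (1 - a b)\<close>. A prime
  \<open>P\<close> that misses \<open>T\<close> would be maximal and would not contain \<open>a\<close>, so \<open>1 - a b \<in> P\<close> for some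
  \<open>b\<close>, although \<open>1 - a b \<in> T\<close>. Hence \<open>0 \<in> T\<close>, that is \<open>a^k (1 - a b) = 0\<close>, and reducedness lowers
  the exponent \<open>k\<close> to \<open>1\<close>: this is \<open>strongly_regular_if_primes_maximal\<close>.

  Now let \<open>K\<close> be any commutative strongly regular subring of a ring \<open>S\<close> and let \<open>S\<close> be generated by
  finitely many elements as a left \<open>K\<close>-module. Since \<open>K\<close> need not be central, an element \<open>s\<close> of \<open>S\<close>
  is studied through the map \<open>x \<mapsto> x s\<close>, which is \<open>K\<close>-linear. Localised at a prime \<open>P\<close> of \<open>K\<close>,
  the ring \<open>K\<close> becomes a field, since every element of \<open>P\<close> is killed by something outside
  \<open>P\<close>. So sufficiently many powers of \<open>x \<mapsto> x s\<close> satisfy a linear relation with a coefficient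
  outside \<open>P\<close> (\<open>power_relation\<close>). Solving it for the lowest power whose coefficient is outside
  \<open>P\<close> gives \<open>k \<notin> P\<close> and a map \<open>\<psi>\<close> commuting with right multiplication by \<open>s\<close> such that
  \<open>k x s^N = \<psi>(x) s^(N + 1)\<close> for all \<open>x\<close>, with \<open>N\<close> independent of \<open>P\<close> (\<open>local_descent\<close>).
  The elements \<open>k\<close> admitting such a \<open>\<psi>\<close> form an ideal contained in no prime, so \<open>1\<close> is
  one of them. The resulting identity \<open>x s^N = \<psi>(x) s^(N + 1)\<close> says two things: \<open>S s^N = S s^(N + 1)\<close>
  (take \<open>x = 1\<close>), and whatever \<open>s^(N + 1)\<close> annihilates on its left is already annihilated by \<open>s^N\<close>.
  Together they also stop the chain of right ideals (\<open>strongly_pi_regular_elemI\<close>), because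
  they provide a group inverse for a power of \<open>s\<close>.

  Extensions that are generated as right modules are reduced to this case by passing to the
  opposite ring, and the matrix ring is generated by the matrix units over the scalar matrices.
\<close>

section \<open>Reduced commutative rings whose primes are maximal\<close>

text \<open>An ideal that is maximal among those missing \<open>T\<close> is prime: if it contained \<open>a b\<close> but
  neither factor, two passages to larger colon ideals would produce a product of two elements of \<open>T\<close>
  inside it. With \<open>T = {1}\<close> this is the existence of a prime above a proper ideal.\<close>
lemma (in cring) prime_ideal_avoiding:
  assumes I: "ideal I R" and T: "T \<subseteq> carrier R" "\<one> \<in> T"
    and closed: "\<And>s t. s \<in> T \<Longrightarrow> t \<in> T \<Longrightarrow> s \<otimes> t \<in> T"
    and disj: "I \<inter> T = {}"
  obtains P where "primeideal P R" "I \<subseteq> P" "P \<inter> T = {}"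
proof -
  define \<A> where "\<A> = {J. ideal J R \<and> I \<subseteq> J \<and> J \<inter> T = {}}"
  have "\<exists>M\<in>\<A>. \<forall>J\<in>\<A>. M \<subseteq> J \<longrightarrow> J = M"
  proof (rule subset_Zorn_nonempty)
    show "\<A> \<noteq> {}" using I disj by (auto simp: \<A>_def)
    fix C assume C: "C \<noteq> {}" "subset.chain \<A> C"
    have "subset.chain {J. ideal J R} C"
      using C(2) by (auto simp: subset.chain_def \<A>_def)
    from chain_Union_is_ideal[OF this] have "ideal (\<Union>C) R" using C(1) by simp
    moreover have "C \<subseteq> \<A>" using C(2) by (simp add: subset.chain_def)
    then have "I \<subseteq> \<Union>C" "\<Union>C \<inter> T = {}"
      using C(1) unfolding \<A>_def by blast+
    ultimately show "\<Union>C \<in> \<A>" by (simp add: \<A>_def)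
  qed
  then obtain M where M: "M \<in> \<A>" and max: "\<And>J. J \<in> \<A> \<Longrightarrow> M \<subseteq> J \<Longrightarrow> J = M" by blast
  have idM: "ideal M R" and IM: "I \<subseteq> M" and MT: "M \<inter> T = {}" using M by (auto simp: \<A>_def)
  interpret M: ideal M R by (rule idM)
  \<comment> \<open>The colon ideal of \<open>a\<close> strictly contains \<open>M\<close>, so by maximality it meets \<open>T\<close>.\<close>
  have colon: "\<exists>t\<in>T. a \<otimes> t \<in> M"
    if a: "a \<in> carrier R" and b: "b \<in> carrier R" "a \<otimes> b \<in> M" "b \<notin> M" for a b
  proof (rule ccontr)
    assume none: "\<not> (\<exists>t\<in>T. a \<otimes> t \<in> M)"
    let ?J = "{x \<in> carrier R. a \<otimes> x \<in> M}"
    have "ideal ?J R" by (rule M.helper_max_prime[OF is_cring a])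
    moreover have MJ: "M \<subseteq> ?J" using M.I_l_closed[OF _ a] M.Icarr by blast
    ultimately have "?J \<in> \<A>" using IM none by (auto simp: \<A>_def)
    with max MJ have "?J = M" by blast
    with b show False by blast
  qed
  have "primeideal M R"
  proof (rule primeidealI[OF idM is_cring])
    show "carrier R \<noteq> M" using T MT by blast
    fix a b assume ab: "a \<in> carrier R" "b \<in> carrier R" "a \<otimes> b \<in> M"
    show "a \<in> M \<or> b \<in> M"
    proof (rule ccontr)
      assume "\<not> (a \<in> M \<or> b \<in> M)"
      then have na: "a \<notin> M" and nb: "b \<notin> M" by auto
      obtain t where t: "t \<in> T" "a \<otimes> t \<in> M" using colon[OF ab nb] by blast
      have tc: "t \<in> carrier R" using t T by blast
      have "t \<otimes> a \<in> M" using t(2) ab(1) tc by (simp add: m_comm)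
      from colon[OF tc ab(1) this na] obtain t' where "t' \<in> T" "t \<otimes> t' \<in> M" by blast
      with closed[OF t(1)] MT show False by blast
    qed
  qed
  then show ?thesis using that IM MT by blast
qed

text \<open>A prime that misses \<open>T = {a^k (1 - a b)}\<close> cannot exist: it is maximal and omits \<open>a\<close>, so \<open>a\<close>
  is invertible modulo it, which puts some \<open>1 - a b\<close> into it. So \<open>0 \<in> T\<close>.\<close>
lemma (in cring) strongly_regular_if_primes_maximal:
  assumes reduced: "\<And>a. a \<in> carrier R \<Longrightarrow> a \<otimes> a = \<zero> \<Longrightarrow> a = \<zero>"
    and max: "\<And>P. primeideal P R \<Longrightarrow> maximalideal P R"
  shows "strongly_regular R"
  unfolding strongly_regular_def
proof (intro conjI ballI)
  show "ring R" by (rule ring_axioms)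
  fix a assume a: "a \<in> carrier R"
  define T where "T = {a [^] k \<otimes> (\<one> \<ominus> a \<otimes> b) | (k::nat) b. b \<in> carrier R}"
  have T: "T \<subseteq> carrier R"
  proof
    fix t assume "t \<in> T"
    then obtain k :: nat and b where "b \<in> carrier R" "t = a [^] k \<otimes> (\<one> \<ominus> a \<otimes> b)"
      unfolding T_def by blast
    then show "t \<in> carrier R" using a by simp
  qed
  have TI: "a [^] k \<otimes> (\<one> \<ominus> a \<otimes> b) \<in> T" if "b \<in> carrier R" for k :: nat and b
    using that unfolding T_def by blast
  have one: "\<one> \<in> T"
  proof -
    have "a [^] (0::nat) \<otimes> (\<one> \<ominus> a \<otimes> \<zero>) = \<one>" using a by (simp add: a_minus_def)
    then show ?thesis using TI[of \<zero> 0] by simp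
  qed
  have aT: "a \<in> T"
  proof -
    have "a [^] (1::nat) \<otimes> (\<one> \<ominus> a \<otimes> \<zero>) = a" using a by (simp add: a_minus_def)
    then show ?thesis using TI[of \<zero> 1] by simp
  qed
  have closed: "s \<otimes> t \<in> T" if st: "s \<in> T" "t \<in> T" for s t
  proof -
    obtain k b l c where s: "s = a [^] (k::nat) \<otimes> (\<one> \<ominus> a \<otimes> b)" "b \<in> carrier R"
      and t: "t = a [^] (l::nat) \<otimes> (\<one> \<ominus> a \<otimes> c)" "c \<in> carrier R"
      using st unfolding T_def by blast
    \<comment> \<open>\<open>(1 - a b) (1 - a c) = 1 - a (b + c - a b c)\<close>\<close>
    let ?d = "b \<oplus> c \<ominus> a \<otimes> b \<otimes> c"
    define p q where "p = a [^] k" and "q = a [^] l"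
    have pq: "p \<in> carrier R" "q \<in> carrier R" "a [^] (k + l) = p \<otimes> q"
      using a by (auto simp: p_def q_def nat_pow_mult)
    have "s \<otimes> t = p \<otimes> (\<one> \<ominus> a \<otimes> b) \<otimes> (q \<otimes> (\<one> \<ominus> a \<otimes> c))"
      by (simp add: s t p_def q_def)
    also have "\<dots> = p \<otimes> q \<otimes> ((\<one> \<ominus> a \<otimes> b) \<otimes> (\<one> \<ominus> a \<otimes> c))"
      using a pq(1,2) s(2) t(2) by (simp add: m_ac)
    also have "(\<one> \<ominus> a \<otimes> b) \<otimes> (\<one> \<ominus> a \<otimes> c) = \<one> \<ominus> a \<otimes> ?d"
      using a s(2) t(2) by algebra
    finally have "s \<otimes> t = a [^] (k + l) \<otimes> (\<one> \<ominus> a \<otimes> ?d)" by (simp add: pq)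
    then show ?thesis using TI[of ?d "k + l"] a s(2) t(2) by simp
  qed
  have "\<zero> \<in> T"
  proof (rule ccontr)
    assume "\<zero> \<notin> T"
    then have "{\<zero>} \<inter> T = {}" by blast
    then obtain P where P: "primeideal P R" "P \<inter> T = {}"
      using prime_ideal_avoiding[OF zeroideal T one closed] by metis
    interpret P: maximalideal P R by (rule max[OF P(1)])
    have "ideal (P <+>\<^bsub>R\<^esub> PIdl a) R"
      by (rule add_ideals[OF P.is_ideal cgenideal_ideal[OF a]])
    moreover have sub: "P \<subseteq> P <+>\<^bsub>R\<^esub> PIdl a"
    proof
      fix p assume p: "p \<in> P"
      have "\<zero> \<otimes> a \<in> PIdl a" unfolding cgenideal_def by blast
      then have "\<zero> \<in> PIdl a" using a by simp
      then have "p \<oplus> \<zero> \<in> P <+>\<^bsub>R\<^esub> PIdl a" using p unfolding set_add_def' by blast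
      then show "p \<in> P <+>\<^bsub>R\<^esub> PIdl a" using p P.Icarr by simp
    qed
    moreover have "a \<in> P <+>\<^bsub>R\<^esub> PIdl a"
    proof -
      have "\<zero> \<oplus> a \<in> P <+>\<^bsub>R\<^esub> PIdl a"
        using cgenideal_self[OF a] P.zero_closed unfolding set_add_def' by blast
      then show ?thesis using a by simp
    qed
    moreover have "a \<notin> P" using aT P(2) by blast
    moreover have "P <+>\<^bsub>R\<^esub> PIdl a \<subseteq> carrier R"
      using ideal.Icarr[OF calculation(1)] by blast
    ultimately have "P <+>\<^bsub>R\<^esub> PIdl a = carrier R"
      using P.I_maximal[of "P <+>\<^bsub>R\<^esub> PIdl a"] by metis
    then have "\<one> \<in> P <+>\<^bsub>R\<^esub> PIdl a" by simp
    then obtain p r where pr: "p \<in> P" "r \<in> carrier R" "\<one> = p \<oplus> r \<otimes> a"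
      unfolding set_add_def' cgenideal_def by blast
    have pc: "p \<in> carrier R" using pr(1) P.Icarr by blast
    have "a [^] (0::nat) \<otimes> (\<one> \<ominus> a \<otimes> r) = p \<oplus> r \<otimes> a \<ominus> a \<otimes> r"
      using a pr(2) pc by (simp flip: pr(3))
    also have "\<dots> = p" using a pr(2) pc by algebra
    finally have "a [^] (0::nat) \<otimes> (\<one> \<ominus> a \<otimes> r) = p" .
    then have "p \<in> T" using TI[OF pr(2), of 0] by simp
    then show False using pr(1) P(2) by blast
  qed
  then obtain k b where b: "b \<in> carrier R" and z: "\<zero> = a [^] (k::nat) \<otimes> (\<one> \<ominus> a \<otimes> b)"
    unfolding T_def by blast
  define e where "e = \<one> \<ominus> a \<otimes> b"
  have e: "e \<in> carrier R" using a b by (simp add: e_def)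
  have cancel: "a \<otimes> e = \<zero>" if "a [^] k \<otimes> e = \<zero>" for k :: nat
    using that
  proof (induction k)
    case 0 then show ?case using a e by simp
  next
    case (Suc k)
    show ?case
    proof (cases k)
      case 0 then show ?thesis using Suc.prems a by simp
    next
      case (Suc j)
      let ?y = "a [^] k \<otimes> e"
      define p where "p = a [^] j"
      have p: "p \<in> carrier R" using a by (simp add: p_def)
      \<comment> \<open>With \<open>k\<close> at least \<open>1\<close>, the square of \<open>a^k e\<close> is a multiple of \<open>a^(k + 1) e = 0\<close>.\<close>
      have "?y \<otimes> ?y = (a [^] Suc k \<otimes> e) \<otimes> (p \<otimes> e)"
        using a e p unfolding Suc nat_pow_Suc p_def[symmetric] by (simp add: m_ac)
      also have "\<dots> = \<zero>" using Suc.prems e p by simp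
      finally have "?y = \<zero>" using reduced[of ?y] a e by blast
      then show ?thesis by (rule Suc.IH)
    qed
  qed
  have "a \<otimes> a \<otimes> b = a \<ominus> a \<otimes> e" using a b unfolding e_def by algebra
  also have "a \<otimes> e = \<zero>" using cancel[of k] z unfolding e_def by metis
  finally have "a [^] (2::nat) \<otimes> b = a" using a by (simp add: numeral_2_eq_2 a_minus_def)
  then show "\<exists>b\<in>carrier R. a = a [^] (2::nat) \<otimes> b"
    using b by metis
qed

section \<open>A one-sided criterion for strong pi-regularity\<close>

text \<open>The hypotheses propagate from one power of \<open>s\<close> to all later ones. For \<open>b = s^(m + 1)\<close> they give
  \<open>b = v b^2\<close> and allow the step from \<open>x b^2 = y b^2\<close> to \<open>x b = y b\<close>.
  Such cancellations show that \<open>w = v^2 b\<close> is a group inverse of \<open>b\<close>; in particular \<open>b = b^2 w\<close>, which is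
  the missing condition on the right.\<close>
lemma (in ring) strongly_pi_regular_elemI:
  assumes s: "s \<in> carrier R" and u: "u \<in> carrier R" and su: "s [^] m = u \<otimes> s [^] Suc m"
    and ann: "\<And>x. x \<in> carrier R \<Longrightarrow> x \<otimes> s [^] Suc m = \<zero> \<Longrightarrow> x \<otimes> s [^] m = \<zero>"
  shows "strongly_pi_regular_elem R s"
proof -
  have left: "\<exists>v\<in>carrier R. s [^] m = v \<otimes> s [^] (m + k)" for k
  proof (induction k)
    case 0 show ?case using s by (auto intro!: bexI[of _ \<one>])
  next
    case (Suc k)
    then obtain v where v: "v \<in> carrier R" "s [^] m = v \<otimes> s [^] (m + k)" by blast
    have "s [^] m = u \<otimes> (s [^] m \<otimes> s)" using su by simp
    also have "\<dots> = u \<otimes> v \<otimes> s [^] (m + Suc k)"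
      unfolding v(2) using s u v(1) by (simp add: m_assoc)
    finally show ?case using u v(1) by blast
  qed
  have ann_add: "x \<otimes> s [^] m = \<zero>" if "x \<in> carrier R" "x \<otimes> s [^] (m + k) = \<zero>" for x k
    using that
  proof (induction k arbitrary: x)
    case (Suc k)
    have "(x \<otimes> s) \<otimes> s [^] (m + k) = x \<otimes> s [^] (m + Suc k)"
      using Suc.prems(1) s nat_pow_Suc2[OF s, of "m + k"] by (simp add: m_assoc)
    then have "(x \<otimes> s) \<otimes> s [^] m = \<zero>" using Suc s by simp
    then have "x \<otimes> s [^] Suc m = \<zero>"
      using Suc.prems(1) s nat_pow_Suc2[OF s, of m] by (simp add: m_assoc)
    then show ?case using ann Suc.prems(1) by blast
  qed simp
  \<comment> \<open>The exponent is raised by one so that \<open>b\<close> has the factor \<open>s\<close> even for \<open>m = 0\<close>; then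
    \<open>b = b^2 w\<close> reads \<open>s^n = s^(n + 1) z\<close>.\<close>
  define n where "n = Suc m"
  define b where "b = s [^] n"
  have b: "b \<in> carrier R" using s by (simp add: b_def)
  have bb: "b \<otimes> b = s [^] (m + (m + 2))" 
  proof -
    have "b \<otimes> b = s [^] (n + n)" by (simp only: b_def nat_pow_mult[OF s])
    also have "n + n = m + (m + 2)" by (simp add: n_def)
    finally show ?thesis .
  qed
  obtain v where v: "v \<in> carrier R" "b = v \<otimes> (b \<otimes> b)"
  proof -
    obtain v where v: "v \<in> carrier R" "s [^] m = v \<otimes> s [^] (m + Suc m)" using left by blast
    have "b = s [^] m \<otimes> s" by (simp add: b_def n_def)
    also have "\<dots> = v \<otimes> (b \<otimes> b)" unfolding v(2) bb using v(1) s by (simp add: m_assoc)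
    finally show ?thesis using that v(1) by blast
  qed
  have ann_b: "x \<otimes> b = \<zero>" if x: "x \<in> carrier R" "x \<otimes> b \<otimes> b = \<zero>" for x
  proof -
    have "x \<otimes> s [^] (m + (m + 2)) = \<zero>" using x b by (simp only: m_assoc flip: bb)
    then have "x \<otimes> s [^] m = \<zero>" using ann_add x(1) by blast
    moreover have "x \<otimes> b = x \<otimes> s [^] m \<otimes> s" using x(1) s by (simp add: b_def n_def m_assoc)
    ultimately show ?thesis using s by simp
  qed
  have cancel: "x \<otimes> b = y \<otimes> b" if "x \<in> carrier R" "y \<in> carrier R" "x \<otimes> b \<otimes> b = y \<otimes> b \<otimes> b" for x y
  proof -
    have "(x \<ominus> y) \<otimes> b \<otimes> b = \<zero>" using that b by algebra
    then have "(x \<ominus> y) \<otimes> b = \<zero>" using ann_b that by simp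
    then have "x \<otimes> b \<ominus> y \<otimes> b = \<zero>" using that b by (simp add: l_distr l_minus a_minus_def)
    then show ?thesis using that b by simp
  qed
  have bvb: "b \<otimes> v \<otimes> b = b"
    using cancel[of "b \<otimes> v" \<one>] b v(1) by (simp add: m_assoc flip: v(2))
  have bvvb: "b \<otimes> v \<otimes> v \<otimes> b = v \<otimes> b"
  proof (rule cancel)
    have "b \<otimes> v \<otimes> v \<otimes> b \<otimes> b = b \<otimes> v \<otimes> (v \<otimes> (b \<otimes> b))" using b v(1) by (simp add: m_assoc)
    also have "\<dots> = v \<otimes> b \<otimes> b" using b v(1) bvb by (simp add: m_assoc flip: v(2))
    finally show "b \<otimes> v \<otimes> v \<otimes> b \<otimes> b = v \<otimes> b \<otimes> b" .
  qed (use b v(1) in auto)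
  define w where "w = v \<otimes> (v \<otimes> b)"
  have w: "w \<in> carrier R" using b v(1) by (simp add: w_def)
  have "b \<otimes> b \<otimes> w = b \<otimes> (b \<otimes> v \<otimes> v \<otimes> b)" using b v(1) by (simp add: w_def m_assoc)
  also have "\<dots> = b" using bvb bvvb b v(1) by (simp add: m_assoc)
  finally have bw: "b = b \<otimes> b \<otimes> w" by simp
  define z where "z = s [^] m \<otimes> w"
  have z: "z \<in> carrier R" using s w by (simp add: z_def)
  have sz: "s [^] n = s [^] Suc n \<otimes> z"
  proof -
    have "s [^] Suc n \<otimes> z = s [^] Suc n \<otimes> s [^] m \<otimes> w"
      using s w by (simp add: z_def m_assoc)
    also have "s [^] Suc n \<otimes> s [^] m = s [^] (Suc n + m)" by (rule nat_pow_mult[OF s])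
    also have "Suc n + m = m + (m + 2)" by (simp add: n_def)
    also have "s [^] (m + (m + 2)) \<otimes> w = b" using bw by (simp add: bb)
    finally show ?thesis by (simp add: b_def)
  qed
  have right: "\<exists>y\<in>carrier R. s [^] n = s [^] (n + k) \<otimes> y" for k
  proof (induction k)
    case 0 show ?case using s by (auto intro!: bexI[of _ \<one>])
  next
    case (Suc k)
    then obtain y where y: "y \<in> carrier R" "s [^] n = s [^] (n + k) \<otimes> y" by blast
    have "s [^] n = s \<otimes> s [^] n \<otimes> z" using sz s by (simp only: nat_pow_Suc2)
    also have "\<dots> = s \<otimes> s [^] (n + k) \<otimes> (y \<otimes> z)"
      unfolding y(2) using s y(1) z by (simp add: m_assoc)
    also have "s \<otimes> s [^] (n + k) = s [^] (n + Suc k)" using nat_pow_Suc2[OF s] by simp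
    finally show ?case using y(1) z by blast
  qed
  show ?thesis
    unfolding strongly_pi_regular_elem_def
  proof (intro conjI exI allI impI)
    fix k assume "m \<le> k"
    then obtain j where k: "k = m + j" using le_Suc_ex by blast
    obtain v where v: "v \<in> carrier R" "s [^] m = v \<otimes> s [^] k" using left[of j] k by blast
    show "{x \<otimes> s [^] k |x. x \<in> carrier R} = {x \<otimes> s [^] m |x. x \<in> carrier R}"
    proof (intro equalityI subsetI)
      fix y assume "y \<in> {x \<otimes> s [^] k |x. x \<in> carrier R}"
      then obtain x where x: "x \<in> carrier R" "y = x \<otimes> s [^] k" by blast
      have "y = (x \<otimes> s [^] j) \<otimes> s [^] m"
        using x s by (simp add: k m_assoc nat_pow_mult add.commute)
      then show "y \<in> {x \<otimes> s [^] m |x. x \<in> carrier R}" using x(1) s by blast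
    next
      fix y assume "y \<in> {x \<otimes> s [^] m |x. x \<in> carrier R}"
      then obtain x where x: "x \<in> carrier R" "y = x \<otimes> s [^] m" by blast
      have "y = (x \<otimes> v) \<otimes> s [^] k" using x v s by (simp add: m_assoc)
      then show "y \<in> {x \<otimes> s [^] k |x. x \<in> carrier R}" using x(1) v(1) by blast
    qed
  next
    fix k assume "n \<le> k"
    then obtain j where k: "k = n + j" using le_Suc_ex by blast
    obtain v where v: "v \<in> carrier R" "s [^] n = s [^] k \<otimes> v" using right[of j] k by blast
    show "{s [^] k \<otimes> x |x. x \<in> carrier R} = {s [^] n \<otimes> x |x. x \<in> carrier R}"
    proof (intro equalityI subsetI)
      fix y assume "y \<in> {s [^] k \<otimes> x |x. x \<in> carrier R}"
      then obtain x where x: "x \<in> carrier R" "y = s [^] k \<otimes> x" by blast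
      have "y = s [^] n \<otimes> (s [^] j \<otimes> x)"
        using x s by (simp add: k nat_pow_mult flip: m_assoc)
      then show "y \<in> {s [^] n \<otimes> x |x. x \<in> carrier R}" using x(1) s by blast
    next
      fix y assume "y \<in> {s [^] n \<otimes> x |x. x \<in> carrier R}"
      then obtain x where x: "x \<in> carrier R" "y = s [^] n \<otimes> x" by blast
      have "y = s [^] k \<otimes> (v \<otimes> x)" using x v s by (simp add: m_assoc)
      then show "y \<in> {s [^] k \<otimes> x |x. x \<in> carrier R}" using x(1) v(1) by blast
    qed
  qed
qed

section \<open>Linear relations over a commutative strongly regular subring\<close>

lemma (in abelian_monoid) finsum_swap:
  assumes "finite A" "finite B" "\<And>i j. i \<in> A \<Longrightarrow> j \<in> B \<Longrightarrow> f i j \<in> carrier G"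
  shows "(\<Oplus>i\<in>A. \<Oplus>j\<in>B. f i j) = (\<Oplus>j\<in>B. \<Oplus>i\<in>A. f i j)"
  using assms(1,3)
proof (induction A rule: finite_induct)
  case empty
  then show ?case by (simp add: finsum_zero)
next
  case (insert a A)
  have "(\<Oplus>i\<in>insert a A. \<Oplus>j\<in>B. f i j) = (\<Oplus>j\<in>B. f a j) \<oplus> (\<Oplus>j\<in>B. \<Oplus>i\<in>A. f i j)"
    using insert by (subst finsum_insert) (auto intro!: finsum_closed)
  also have "\<dots> = (\<Oplus>j\<in>B. f a j \<oplus> (\<Oplus>i\<in>A. f i j))"
    using insert by (subst finsum_addf) (auto intro!: finsum_closed)
  also have "\<dots> = (\<Oplus>j\<in>B. \<Oplus>i\<in>insert a A. f i j)"
    using insert by (intro finsum_cong') (auto intro!: finsum_closed finsum_insert[symmetric])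
  finally show ?case .
qed

text \<open>The subring \<open>K\<close> is commutative but not assumed central: the locale makes \<open>R\<close> a left and a right
  \<open>K\<close>-module whose scalars need not commute with the elements of \<open>R\<close>.\<close>
locale regular_subcring = ring R + subcring K R for K and R (structure) +
  assumes regular: "a \<in> K \<Longrightarrow> \<exists>b\<in>K. a = a \<otimes> a \<otimes> b"
begin

lemma sub_carrier [simp, intro]: "a \<in> K \<Longrightarrow> a \<in> carrier R"
  using subset by blast

lemmas K_closed = subcringE(2,3,5,6,7)[OF subcring_axioms]

lemma K_cring: "cring (R\<lparr>carrier := K\<rparr>)"
  using subcring_iff[OF subset] subcring_axioms by blast

lemma K_finsum_closed: "finite A \<Longrightarrow> f \<in> A \<rightarrow> K \<Longrightarrow> (\<Oplus>i\<in>A. f i) \<in> K"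
proof (induction A rule: finite_induct)
  case (insert a A)
  then have "(\<Oplus>i\<in>insert a A. f i) = f a \<oplus> (\<Oplus>i\<in>A. f i)"
    by (subst finsum_insert) auto
  then show ?case using insert K_closed(5) by auto
qed (simp add: K_closed)

context
  fixes P
  assumes P: "primeideal P (R\<lparr>carrier := K\<rparr>)"
begin

interpretation P: primeideal P "R\<lparr>carrier := K\<rparr>" by (rule P)

lemma P_subset: "a \<in> P \<Longrightarrow> a \<in> K"
  using P.Icarr by simp

lemma one_not_in_P: "\<one> \<notin> P"
  using P.one_imp_carrier P.I_notcarr by auto

lemma complement_mult: "a \<in> K - P \<Longrightarrow> b \<in> K - P \<Longrightarrow> a \<otimes> b \<in> K - P"
  using P.I_prime[of a b] K_closed(4) by auto

text \<open>This is the sense in which \<open>K\<close> localised at \<open>P\<close> is a field: if \<open>a = a^2 b\<close>, then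
  \<open>1 - a b\<close> kills \<open>a\<close>, and it is not in \<open>P\<close> when \<open>a\<close> is.\<close>
lemma annihilator:
  assumes a: "a \<in> P"
  shows "\<exists>t\<in>K - P. t \<otimes> a = \<zero>"
proof -
  have aK: "a \<in> K" using a by (rule P_subset)
  obtain b where b: "b \<in> K" "a = a \<otimes> a \<otimes> b" using regular[OF aK] by blast
  define t where "t = \<one> \<ominus> a \<otimes> b"
  have ab: "a \<otimes> b \<in> P" using P.I_r_closed[OF a] b(1) by simp
  have t: "t \<in> K" using aK b(1) K_closed by (simp add: t_def a_minus_def)
  have "t \<notin> P"
  proof
    assume "t \<in> P"
    then have "t \<oplus> a \<otimes> b \<in> P" using additive_subgroup.a_closed[OF P.is_additive_subgroup _ ab] by simp
    moreover have "t \<oplus> a \<otimes> b = \<one>" using aK b(1) unfolding t_def a_minus_def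
      by (simp add: a_assoc l_neg)
    ultimately show False using one_not_in_P by simp
  qed
  moreover have "t \<otimes> a = \<zero>"
  proof -
    have "t \<otimes> a = a \<ominus> a \<otimes> b \<otimes> a" using aK b(1) unfolding t_def a_minus_def
      by (simp add: l_distr l_minus)
    also have "a \<otimes> b \<otimes> a = a \<otimes> a \<otimes> b"
      using sub_m_comm[OF b(1) aK] aK b(1) by (simp add: m_assoc)
    also have "a \<ominus> a \<otimes> a \<otimes> b = \<zero>" using aK unfolding b(2)[symmetric] by (simp add: a_minus_def r_neg)
    finally show ?thesis .
  qed
  ultimately show ?thesis using t by blast
qed

lemma common_annihilator:
  assumes "finite A" "A \<subseteq> P"
  shows "\<exists>t\<in>K - P. \<forall>a\<in>A. t \<otimes> a = \<zero>"
  using assms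
proof (induction A rule: finite_induct)
  case empty
  show ?case using one_not_in_P K_closed(2) by blast
next
  case (insert a A)
  then obtain t where t: "t \<in> K - P" "\<forall>a\<in>A. t \<otimes> a = \<zero>" by auto
  obtain t' where t': "t' \<in> K - P" "t' \<otimes> a = \<zero>" using annihilator insert.prems by auto
  have "t \<otimes> t' \<otimes> x = \<zero>" if x: "x \<in> insert a A" for x
  proof -
    have xK: "x \<in> K" using x insert.prems P_subset by blast
    show ?thesis
    proof (cases "x = a")
      case True
      then show ?thesis using t t' xK by (simp add: m_assoc)
    next
      case False
      then have "t \<otimes> x = \<zero>" using x t(2) by blast
      then have "t' \<otimes> (t \<otimes> x) = \<zero>" using t' by simp
      moreover have "t \<otimes> t' = t' \<otimes> t" using sub_m_comm t t' by blast
      ultimately show ?thesis using t t' xK by (simp add: m_assoc)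
    qed
  qed
  then show ?case using complement_mult[OF t(1) t'(1)] by blast
qed

text \<open>More vectors than coordinates are linearly dependent over the field obtained by localising at
  \<open>P\<close>. The proof is Gaussian elimination without division: entries in \<open>P\<close> count as zero because a
  common multiplier outside \<open>P\<close> kills them, and entries outside \<open>P\<close> serve as pivots because products
  of elements outside \<open>P\<close> stay outside \<open>P\<close>. The relation obtained holds exactly, not only modulo
  \<open>P\<close>.\<close>
lemma linear_relation:
  assumes "finite J" "finite V" "card J < card V"
    and "\<And>i j. i \<in> V \<Longrightarrow> j \<in> J \<Longrightarrow> v i j \<in> K"
  shows "\<exists>c. c \<in> V \<rightarrow> K \<and> (\<exists>i\<in>V. c i \<notin> P) \<and> (\<forall>j\<in>J. (\<Oplus>i\<in>V. c i \<otimes> v i j) = \<zero>)"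
  using assms
proof (induction J arbitrary: V v rule: finite_induct)
  case empty
  then have "V \<noteq> {}" by auto
  then show ?case using K_closed(2) one_not_in_P by (intro exI[of _ "\<lambda>_. \<one>"]) auto
next
  case (insert j J)
  show ?case
  proof (cases "\<forall>i\<in>V. v i j \<in> P")
    case True
    have "\<exists>c. c \<in> V \<rightarrow> K \<and> (\<exists>i\<in>V. c i \<notin> P) \<and> (\<forall>j\<in>J. (\<Oplus>i\<in>V. c i \<otimes> v i j) = \<zero>)"
      by (rule insert.IH) (use insert in auto)
    then obtain c where c: "c \<in> V \<rightarrow> K" "\<exists>i\<in>V. c i \<notin> P"
      and rel: "\<forall>j\<in>J. (\<Oplus>i\<in>V. c i \<otimes> v i j) = \<zero>" by blast
    obtain t where t: "t \<in> K - P" and tv: "\<forall>a\<in>(\<lambda>i. v i j) ` V. t \<otimes> a = \<zero>"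
      using common_annihilator[of "(\<lambda>i. v i j) ` V"] True insert.prems(1) by blast
    have "(\<Oplus>i\<in>V. (t \<otimes> c i) \<otimes> v i l) = \<zero>" if l: "l \<in> insert j J" for l
    proof (cases "l = j")
      case True
      have "t \<otimes> c i \<otimes> v i l = \<zero>" if i: "i \<in> V" for i
      proof -
        have K: "c i \<in> K" "v i l \<in> K" using c i l insert.prems by auto
        have "t \<otimes> c i \<otimes> v i l = c i \<otimes> (t \<otimes> v i l)"
          using sub_m_comm[of t "c i"] t K by (simp add: m_assoc)
        then show ?thesis using tv i True K by simp
      qed
      then have "(\<Oplus>i\<in>V. (t \<otimes> c i) \<otimes> v i l) = (\<Oplus>i\<in>V. \<zero>)" by (intro finsum_cong') auto
      then show ?thesis by simp
    next
      case False
      have K: "c i \<in> K" "v i l \<in> K" if "i \<in> V" for i using c that l insert.prems by auto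
      have "(\<Oplus>i\<in>V. (t \<otimes> c i) \<otimes> v i l) = (\<Oplus>i\<in>V. t \<otimes> (c i \<otimes> v i l))"
        using t K by (intro finsum_cong') (auto simp: m_assoc)
      also have "\<dots> = t \<otimes> (\<Oplus>i\<in>V. c i \<otimes> v i l)"
        using t K insert.prems(1) by (intro finsum_rdistr[symmetric]) auto
      also have "\<dots> = \<zero>" using rel l False t by simp
      finally show ?thesis .
    qed
    moreover have "(\<lambda>i. t \<otimes> c i) \<in> V \<rightarrow> K" using t c K_closed(4) by auto
    moreover have "\<exists>i\<in>V. t \<otimes> c i \<notin> P"
      using c complement_mult[OF t] by blast
    ultimately show ?thesis by (intro exI[of _ "\<lambda>i. t \<otimes> c i"]) blast
  next
    case False
    then obtain p where p: "p \<in> V" "v p j \<notin> P" by blast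
    define a where "a i = v i j" for i
    have a: "a i \<in> K" if "i \<in> V" for i using that insert.prems by (simp add: a_def)
    let ?V = "V - {p}"
    \<comment> \<open>Cross-multiplying with the pivot row \<open>p\<close> clears column \<open>j\<close>.\<close>
    define w where "w i l = a p \<otimes> v i l \<ominus> a i \<otimes> v p l" for i l
    have vK: "v i l \<in> K" if "i \<in> V" "l \<in> insert j J" for i l using that insert.prems by blast
    have wK: "w i l \<in> K" if "i \<in> V" "l \<in> insert j J" for i l
      using that vK a p(1) K_closed by (simp add: w_def a_minus_def)
    have "\<exists>c. c \<in> ?V \<rightarrow> K \<and> (\<exists>i\<in>?V. c i \<notin> P) \<and> (\<forall>l\<in>J. (\<Oplus>i\<in>?V. c i \<otimes> w i l) = \<zero>)"
    proof (rule insert.IH)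
      show "card J < card ?V" using insert.prems insert.hyps p by simp
    qed (use insert.prems wK in auto)
    then obtain d where d: "d \<in> ?V \<rightarrow> K" "\<exists>i\<in>?V. d i \<notin> P"
      and rel: "\<forall>l\<in>J. (\<Oplus>i\<in>?V. d i \<otimes> w i l) = \<zero>" by blast
    have dK: "d i \<in> K" if "i \<in> V" "i \<noteq> p" for i using d that by auto
    have finV: "finite ?V" using insert.prems by simp
    \<comment> \<open>A relation \<open>d\<close> between the cleared rows becomes one between the original rows after its
      coefficients are multiplied by the pivot; \<open>- s\<close> is the coefficient of the pivot row.\<close>
    define s where "s = (\<Oplus>i\<in>?V. d i \<otimes> a i)"
    have sK: "s \<in> K" using d a K_closed(4) finV unfolding s_def by (intro K_finsum_closed) auto
    define c where "c i = (if i = p then \<ominus> s else d i \<otimes> a p)" for i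
    have cK: "c i \<in> K" if "i \<in> V" for i
      using that dK a sK p K_closed by (simp add: c_def)
    have "(\<Oplus>i\<in>V. c i \<otimes> v i l) = (\<Oplus>i\<in>?V. d i \<otimes> w i l)" if l: "l \<in> insert j J" for l
    proof -
      have V: "V = insert p ?V" using p by blast
      have "(\<Oplus>i\<in>V. c i \<otimes> v i l) = c p \<otimes> v p l \<oplus> (\<Oplus>i\<in>?V. c i \<otimes> v i l)"
        using cK vK l p finV by (subst V, subst finsum_insert) auto
      also have "(\<Oplus>i\<in>?V. c i \<otimes> v i l) = (\<Oplus>i\<in>?V. d i \<otimes> w i l \<oplus> d i \<otimes> a i \<otimes> v p l)"
      proof (rule finsum_cong')
        fix i assume i: "i \<in> ?V"
        have K: "d i \<in> K" "a i \<in> K" "a p \<in> K" "v i l \<in> K" "v p l \<in> K"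
          using i dK a vK l p by auto
        show "c i \<otimes> v i l = d i \<otimes> w i l \<oplus> d i \<otimes> a i \<otimes> v p l"
          using i K by (simp add: c_def w_def a_minus_def r_distr r_minus m_assoc a_assoc l_neg)
      qed (use dK wK a vK l p in auto)
      also have "\<dots> = (\<Oplus>i\<in>?V. d i \<otimes> w i l) \<oplus> (\<Oplus>i\<in>?V. d i \<otimes> a i \<otimes> v p l)"
        using dK wK a vK l p by (intro finsum_addf) auto
      also have "(\<Oplus>i\<in>?V. d i \<otimes> a i \<otimes> v p l) = s \<otimes> v p l"
        using dK a vK l p finV unfolding s_def by (intro finsum_ldistr[symmetric]) auto
      also have "c p \<otimes> v p l \<oplus> ((\<Oplus>i\<in>?V. d i \<otimes> w i l) \<oplus> s \<otimes> v p l) = (\<Oplus>i\<in>?V. d i \<otimes> w i l)"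
      proof -
        have D: "(\<Oplus>i\<in>?V. d i \<otimes> w i l) \<in> carrier R"
          using dK wK l by (intro finsum_closed) auto
        have "c p \<otimes> v p l = \<ominus> (s \<otimes> v p l)" using sK vK l p by (simp add: c_def l_minus)
        then show ?thesis using D sK vK[OF p(1) l]
          by (simp add: a_lcomm[of "\<ominus> (s \<otimes> v p l)"] l_neg)
      qed
      finally show ?thesis .
    qed
    moreover have "(\<Oplus>i\<in>?V. d i \<otimes> w i j) = \<zero>"
    proof -
      have "w i j = \<zero>" if "i \<in> V" for i
        using sub_m_comm[OF a[OF p(1)] a[OF that]] a[OF that] a[OF p(1)] K_closed(4)
        unfolding w_def a_def[symmetric] by (simp add: a_minus_def r_neg)
      then have "(\<Oplus>i\<in>?V. d i \<otimes> w i j) = (\<Oplus>i\<in>?V. \<zero>)" using dK by (intro finsum_cong') auto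
      then show ?thesis by simp
    qed
    ultimately have "\<forall>l\<in>insert j J. (\<Oplus>i\<in>V. c i \<otimes> v i l) = \<zero>" using rel by auto
    moreover have "\<exists>i\<in>V. c i \<notin> P"
    proof -
      obtain i where i: "i \<in> ?V" "d i \<notin> P" using d by blast
      have "d i \<otimes> a p \<in> K - P"
        using complement_mult[of "d i" "a p"] i dK a p by (auto simp: a_def)
      then show ?thesis using i by (auto simp: c_def)
    qed
    ultimately show ?thesis using cK by blast
  qed
qed

end

end

section \<open>Finite extensions\<close>

text \<open>These maps stand in for polynomials in right multiplication by \<open>s\<close> with left coefficients in
  \<open>K\<close>. Commutation with \<open>s\<close> and preservation of zero are what the annihilator condition of
  \<open>strongly_pi_regular_elemI\<close> asks of them.\<close>
definition (in ring) equivariant :: "'a \<Rightarrow> ('a \<Rightarrow> 'a) set" where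
  "equivariant s = {\<psi> \<in> carrier R \<rightarrow> carrier R.
     \<psi> \<zero> = \<zero> \<and> (\<forall>x\<in>carrier R. \<psi> (x \<otimes> s) = \<psi> x \<otimes> s)}"

lemma (in ring) equivariant_pow:
  assumes \<psi>: "\<psi> \<in> equivariant s" and s: "s \<in> carrier R" and x: "x \<in> carrier R"
  shows "\<psi> (x \<otimes> s [^] (n::nat)) = \<psi> x \<otimes> s [^] n"
proof (induction n)
  case 0
  then show ?case using \<psi> x by (auto simp: equivariant_def Pi_iff)
next
  case (Suc n)
  have "\<psi> (x \<otimes> s [^] Suc n) = \<psi> ((x \<otimes> s [^] n) \<otimes> s)" using s x by (simp add: m_assoc)
  also have "\<dots> = \<psi> (x \<otimes> s [^] n) \<otimes> s" using \<psi> s x by (simp add: equivariant_def)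
  also have "\<dots> = \<psi> x \<otimes> s [^] Suc n"
    using Suc \<psi> s x by (simp add: m_assoc equivariant_def Pi_iff)
  finally show ?case .
qed

lemma (in ring) equivariantI:
  assumes "\<And>x. x \<in> carrier R \<Longrightarrow> \<psi> x \<in> carrier R" "\<psi> \<zero> = \<zero>"
    and "\<And>x. x \<in> carrier R \<Longrightarrow> \<psi> (x \<otimes> s) = \<psi> x \<otimes> s"
  shows "\<psi> \<in> equivariant s"
  using assms unfolding equivariant_def by blast

lemma (in ring) equivariantD:
  assumes "\<psi> \<in> equivariant s"
  shows "x \<in> carrier R \<Longrightarrow> \<psi> x \<in> carrier R" "\<psi> \<zero> = \<zero>"
    and "x \<in> carrier R \<Longrightarrow> \<psi> (x \<otimes> s) = \<psi> x \<otimes> s"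
  using assms unfolding equivariant_def by blast+

lemma (in ring) equivariant_add:
  assumes \<psi>: "\<psi> \<in> equivariant s" and \<phi>: "\<phi> \<in> equivariant s" and s: "s \<in> carrier R"
  shows "(\<lambda>x. \<psi> x \<oplus> \<phi> x) \<in> equivariant s"
  by (rule equivariantI) (simp_all add: equivariantD[OF \<psi>] equivariantD[OF \<phi>] s l_distr)

lemma (in ring) equivariant_scale:
  assumes \<psi>: "\<psi> \<in> equivariant s" and l: "l \<in> carrier R" and s: "s \<in> carrier R"
  shows "(\<lambda>x. l \<otimes> \<psi> x) \<in> equivariant s"
  by (rule equivariantI) (simp_all add: equivariantD[OF \<psi>] l s m_assoc)

context regular_subcring
begin

context
  fixes I :: "'i set" and g :: "'i \<Rightarrow> 'a" and s :: 'a
  assumes I: "finite I" and g: "\<And>i. i \<in> I \<Longrightarrow> g i \<in> carrier R"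
    and gen: "\<And>x. x \<in> carrier R \<Longrightarrow> \<exists>c\<in>I \<rightarrow> K. x = (\<Oplus>i\<in>I. c i \<otimes> g i)"
    and s: "s \<in> carrier R"
begin

abbreviation (input) bound :: nat where "bound \<equiv> card (I \<times> I)"

text \<open>The relation is \<open>K\<close>-linear in \<open>x\<close>: the coefficients \<open>c i\<close> act on the left, where they commute
  with the coordinates of \<open>x\<close>, and the powers of \<open>s\<close> act on the right.\<close>
lemma power_relation_on_generators:
  fixes N :: nat
  assumes c: "\<And>i. i \<le> N \<Longrightarrow> c i \<in> K"
    and rel: "\<And>a. a \<in> I \<Longrightarrow> (\<Oplus>i\<in>{..N}. c i \<otimes> (g a \<otimes> s [^] i)) = \<zero>"
    and x: "x \<in> carrier R"
  shows "(\<Oplus>i\<in>{..N}. c i \<otimes> (x \<otimes> s [^] i)) = \<zero>"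
proof -
  obtain d where d: "d \<in> I \<rightarrow> K" and x_eq: "x = (\<Oplus>a\<in>I. d a \<otimes> g a)" using gen[OF x] by blast
  have dK: "d a \<in> K" if "a \<in> I" for a using d that by blast
  have summand: "c i \<otimes> (x \<otimes> s [^] i) = (\<Oplus>a\<in>I. d a \<otimes> (c i \<otimes> (g a \<otimes> s [^] i)))" if i: "i \<le> N" for i
  proof -
    have "c i \<otimes> (x \<otimes> s [^] i) = c i \<otimes> (\<Oplus>a\<in>I. d a \<otimes> g a \<otimes> s [^] i)"
      unfolding x_eq using I dK g s by (subst finsum_ldistr) auto
    also have "\<dots> = (\<Oplus>a\<in>I. c i \<otimes> (d a \<otimes> g a \<otimes> s [^] i))"
      using I dK g s c[OF i] by (intro finsum_rdistr) auto
    also have "\<dots> = (\<Oplus>a\<in>I. d a \<otimes> (c i \<otimes> (g a \<otimes> s [^] i)))"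
    proof (rule finsum_cong')
      fix a assume a: "a \<in> I"
      have "c i \<otimes> d a = d a \<otimes> c i" using sub_m_comm c[OF i] dK[OF a] by blast
      then have "c i \<otimes> d a \<otimes> (g a \<otimes> s [^] i) = d a \<otimes> c i \<otimes> (g a \<otimes> s [^] i)" by (rule arg_cong)
      then show "c i \<otimes> (d a \<otimes> g a \<otimes> s [^] i) = d a \<otimes> (c i \<otimes> (g a \<otimes> s [^] i))"
        using c[OF i] dK[OF a] g[OF a] s by (simp add: m_assoc)
    qed (use dK g s c[OF i] in auto)
    finally show ?thesis .
  qed
  have "(\<Oplus>i\<in>{..N}. c i \<otimes> (x \<otimes> s [^] i))
      = (\<Oplus>i\<in>{..N}. \<Oplus>a\<in>I. d a \<otimes> (c i \<otimes> (g a \<otimes> s [^] i)))"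
    using dK c g s summand by (intro finsum_cong') (auto intro!: finsum_closed)
  also have "\<dots> = (\<Oplus>a\<in>I. \<Oplus>i\<in>{..N}. d a \<otimes> (c i \<otimes> (g a \<otimes> s [^] i)))"
    using I dK c g s by (intro finsum_swap) auto
  also have "\<dots> = (\<Oplus>a\<in>I. \<zero>)"
  proof (rule finsum_cong')
    fix a assume a: "a \<in> I"
    have "(\<Oplus>i\<in>{..N}. d a \<otimes> (c i \<otimes> (g a \<otimes> s [^] i)))
        = d a \<otimes> (\<Oplus>i\<in>{..N}. c i \<otimes> (g a \<otimes> s [^] i))"
      using dK[OF a] c g[OF a] s by (intro finsum_rdistr[symmetric]) auto
    then show "(\<Oplus>i\<in>{..N}. d a \<otimes> (c i \<otimes> (g a \<otimes> s [^] i))) = \<zero>"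
      using rel[OF a] dK[OF a] by simp
  qed auto
  finally show ?thesis by simp
qed

text \<open>The elements \<open>g a s^i\<close>, written in terms of the generators, give for each \<open>i\<close> a vector with
  \<open>card (I \<times> I)\<close> coordinates; the powers \<open>0, \<dots>, card (I \<times> I)\<close> are one vector too many.\<close>
lemma power_relation:
  assumes P: "primeideal P (R\<lparr>carrier := K\<rparr>)"
  shows "\<exists>c. (\<forall>i\<le>bound. c i \<in> K) \<and> (\<exists>i\<le>bound. c i \<notin> P) \<and>
    (\<forall>x\<in>carrier R. (\<Oplus>i\<in>{..bound}. c i \<otimes> (x \<otimes> s [^] i)) = \<zero>)"
proof -
  define A where "A i a = (SOME A. A \<in> I \<rightarrow> K \<and> g a \<otimes> s [^] i = (\<Oplus>b\<in>I. A b \<otimes> g b))"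
    for i :: nat and a
  have A_ex: "A i a \<in> I \<rightarrow> K \<and> g a \<otimes> s [^] i = (\<Oplus>b\<in>I. A i a b \<otimes> g b)" if a: "a \<in> I" for i a
  proof -
    have "g a \<otimes> s [^] i \<in> carrier R" using g[OF a] s by simp
    from gen[OF this] have "\<exists>A. A \<in> I \<rightarrow> K \<and> g a \<otimes> s [^] i = (\<Oplus>b\<in>I. A b \<otimes> g b)" by blast
    from someI_ex[OF this] show ?thesis by (simp only: A_def)
  qed
  note A = A_ex[THEN conjunct1] and A_eq = A_ex[THEN conjunct2]
  have AK: "A i a b \<in> K" if "a \<in> I" "b \<in> I" for i a b using A that by blast
  have "\<exists>c. c \<in> {..bound} \<rightarrow> K \<and> (\<exists>i\<in>{..bound}. c i \<notin> P) \<and>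
    (\<forall>j\<in>I \<times> I. (\<Oplus>i\<in>{..bound}. c i \<otimes> A i (fst j) (snd j)) = \<zero>)"
    using I AK by (intro linear_relation[OF P]) auto
  then obtain c where c: "c \<in> {..bound} \<rightarrow> K" "\<exists>i\<in>{..bound}. c i \<notin> P"
    and rel: "\<forall>j\<in>I \<times> I. (\<Oplus>i\<in>{..bound}. c i \<otimes> A i (fst j) (snd j)) = \<zero>" by blast
  have cK: "c i \<in> K" if "i \<le> bound" for i using c that by blast
  have "(\<Oplus>i\<in>{..bound}. c i \<otimes> (g a \<otimes> s [^] i)) = \<zero>" if a: "a \<in> I" for a
  proof -
    have "(\<Oplus>i\<in>{..bound}. c i \<otimes> (g a \<otimes> s [^] i))
        = (\<Oplus>i\<in>{..bound}. \<Oplus>b\<in>I. c i \<otimes> A i a b \<otimes> g b)"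
    proof (rule finsum_cong')
      fix i assume i: "i \<in> {..bound}"
      have "c i \<otimes> (g a \<otimes> s [^] i) = (\<Oplus>b\<in>I. c i \<otimes> (A i a b \<otimes> g b))"
        unfolding A_eq[OF a] using I i cK g AK[OF a] by (intro finsum_rdistr) auto
      also have "\<dots> = (\<Oplus>b\<in>I. c i \<otimes> A i a b \<otimes> g b)"
        using i cK g AK[OF a] by (intro finsum_cong') (auto simp: m_assoc)
      finally show "c i \<otimes> (g a \<otimes> s [^] i) = (\<Oplus>b\<in>I. c i \<otimes> A i a b \<otimes> g b)" .
    qed (use cK g AK[OF a] in \<open>auto intro!: finsum_closed\<close>)
    also have "\<dots> = (\<Oplus>b\<in>I. \<Oplus>i\<in>{..bound}. c i \<otimes> A i a b \<otimes> g b)"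
      using I cK g AK[OF a] by (intro finsum_swap) auto
    also have "\<dots> = (\<Oplus>b\<in>I. \<zero>)"
    proof (rule finsum_cong')
      fix b assume b: "b \<in> I"
      have "(\<Oplus>i\<in>{..bound}. c i \<otimes> A i a b \<otimes> g b) = (\<Oplus>i\<in>{..bound}. c i \<otimes> A i a b) \<otimes> g b"
        using cK g[OF b] AK[OF a b] by (intro finsum_ldistr[symmetric]) auto
      also have "(\<Oplus>i\<in>{..bound}. c i \<otimes> A i a b) = \<zero>" using rel a b by auto
      finally show "(\<Oplus>i\<in>{..bound}. c i \<otimes> A i a b \<otimes> g b) = \<zero>" using g[OF b] by simp
    qed auto
    finally show ?thesis by simp
  qed
  then have "(\<Oplus>i\<in>{..bound}. c i \<otimes> (x \<otimes> s [^] i)) = \<zero>" if "x \<in> carrier R" for x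
    using power_relation_on_generators[of bound c] cK that by blast
  then show ?thesis using c cK by (intro exI[of _ c]) auto
qed

text \<open>In the relation between the powers, take the lowest index \<open>j\<close> with coefficient outside \<open>P\<close>.
  The coefficients below \<open>j\<close> lie in \<open>P\<close> and are killed by some \<open>t \<notin> P\<close>, so
  \<open>t c\<^sub>j x s^j\<close> equals minus the sum of the higher terms, all of which are divisible by \<open>s^(j + 1)\<close> on the right. Multiplying by
  \<open>s^(bound - j)\<close> makes the exponent independent of \<open>P\<close>.\<close>
lemma local_descent:
  assumes P: "primeideal P (R\<lparr>carrier := K\<rparr>)"
  shows "\<exists>k\<in>K - P. \<exists>\<psi>\<in>equivariant s.
    \<forall>x\<in>carrier R. k \<otimes> x \<otimes> s [^] bound = \<psi> x \<otimes> s [^] Suc bound"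
proof -
  let ?N = bound
  obtain c where cK: "\<And>i. i \<le> ?N \<Longrightarrow> c i \<in> K" and cP: "\<exists>i\<le>?N. c i \<notin> P"
    and rel: "\<And>x. x \<in> carrier R \<Longrightarrow> (\<Oplus>i\<in>{..?N}. c i \<otimes> (x \<otimes> s [^] i)) = \<zero>"
    using power_relation[OF P] by blast
  define j where "j = (LEAST i. i \<le> ?N \<and> c i \<notin> P)"
  have j: "j \<le> ?N" "c j \<notin> P" using LeastI_ex[OF cP] by (auto simp: j_def)
  have below: "c i \<in> P" if "i < j" for i
    using not_less_Least[of i "\<lambda>i. i \<le> ?N \<and> c i \<notin> P"] that j(1) by (auto simp: j_def)
  have "c ` {..<j} \<subseteq> P" using below by auto
  then obtain t where t: "t \<in> K - P" and tc: "\<And>i. i < j \<Longrightarrow> t \<otimes> c i = \<zero>"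
    using common_annihilator[OF P, of "c ` {..<j}"] by auto
  have tcK: "t \<otimes> c i \<in> K" if "i \<le> ?N" for i using t cK that K_closed(4) by blast
  define \<psi> where "\<psi> x = \<ominus> (\<Oplus>i\<in>{j<..?N}. t \<otimes> c i \<otimes> (x \<otimes> s [^] (i - Suc j)))" for x
  have regroup: "u \<otimes> x \<otimes> (p \<otimes> q) = u \<otimes> (x \<otimes> p) \<otimes> q"
    if "u \<in> carrier R" "x \<in> carrier R" "p \<in> carrier R" "q \<in> carrier R" for u x p q
    using that by (simp add: m_assoc)
  have \<psi>_closed: "\<psi> x \<in> carrier R" if "x \<in> carrier R" for x
    using that tcK s unfolding \<psi>_def by (intro a_inv_closed finsum_closed) auto
  have \<psi>_mult: "\<psi> x \<otimes> s [^] m = \<ominus> (\<Oplus>i\<in>{j<..?N}. t \<otimes> c i \<otimes> (x \<otimes> s [^] (i - Suc j + m)))"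
    if x: "x \<in> carrier R" for x and m :: nat
  proof -
    let ?h = "\<lambda>i. t \<otimes> c i \<otimes> (x \<otimes> s [^] (i - Suc j))"
    have h: "?h i \<in> carrier R" if "i \<in> {j<..?N}" for i using that tcK[of i] x s by simp
    have "\<psi> x \<otimes> s [^] m = \<ominus> ((\<Oplus>i\<in>{j<..?N}. ?h i) \<otimes> s [^] m)"
      unfolding \<psi>_def using h s by (intro l_minus finsum_closed) auto
    also have "(\<Oplus>i\<in>{j<..?N}. ?h i) \<otimes> s [^] m = (\<Oplus>i\<in>{j<..?N}. ?h i \<otimes> s [^] m)"
      using h s by (intro finsum_ldistr) auto
    also have "(\<Oplus>i\<in>{j<..?N}. t \<otimes> c i \<otimes> (x \<otimes> s [^] (i - Suc j)) \<otimes> s [^] m)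
        = (\<Oplus>i\<in>{j<..?N}. t \<otimes> c i \<otimes> (x \<otimes> s [^] (i - Suc j + m)))"
    proof (rule finsum_cong')
      fix i assume i: "i \<in> {j<..?N}"
      then have "t \<otimes> c i \<in> carrier R" using tcK by auto
      then show "t \<otimes> c i \<otimes> (x \<otimes> s [^] (i - Suc j)) \<otimes> s [^] m
          = t \<otimes> c i \<otimes> (x \<otimes> s [^] (i - Suc j + m))"
        using x s m_assoc[of "t \<otimes> c i" "x \<otimes> s [^] (i - Suc j)" "s [^] m"]
          m_assoc[of x "s [^] (i - Suc j)" "s [^] m"] nat_pow_mult[OF s, of "i - Suc j" m]
        by simp
    qed (use x tcK s in auto)
    finally show ?thesis .
  qed
  have "\<psi> \<in> equivariant s"
  proof -
    have "\<psi> (x \<otimes> s) = \<psi> x \<otimes> s" if x: "x \<in> carrier R" for x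
    proof -
      have "\<psi> (x \<otimes> s) = \<ominus> (\<Oplus>i\<in>{j<..?N}. t \<otimes> c i \<otimes> (x \<otimes> s [^] (i - Suc j + 1)))"
        unfolding \<psi>_def
      proof (intro arg_cong[of _ _ "a_inv R"] finsum_cong')
        fix i assume "i \<in> {j<..?N}"
        show "t \<otimes> c i \<otimes> (x \<otimes> s \<otimes> s [^] (i - Suc j))
            = t \<otimes> c i \<otimes> (x \<otimes> s [^] (i - Suc j + 1))"
          using x s nat_pow_Suc2[OF s, of "i - Suc j"] by (simp add: m_assoc)
      qed (use x tcK s in auto)
      also have "\<dots> = \<psi> x \<otimes> s" using \<psi>_mult[OF x, of 1] s by simp
      finally show ?thesis .
    qed
    moreover have "\<psi> \<zero> = \<zero>"
    proof -
      have "(\<Oplus>i\<in>{j<..?N}. t \<otimes> c i \<otimes> (\<zero> \<otimes> s [^] (i - Suc j))) = (\<Oplus>i\<in>{j<..?N}. \<zero>)"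
        using tcK s by (intro finsum_cong') auto
      then show ?thesis by (simp add: \<psi>_def)
    qed
    ultimately show ?thesis using \<psi>_closed by (auto simp: equivariant_def)
  qed
  moreover have "t \<otimes> c j \<otimes> x \<otimes> s [^] ?N = \<psi> x \<otimes> s [^] Suc ?N" if x: "x \<in> carrier R" for x
  proof -
    let ?f = "\<lambda>i. t \<otimes> c i \<otimes> (x \<otimes> s [^] i)"
    have f: "?f i \<in> carrier R" if "i \<le> ?N" for i using that tcK x s by auto
    have "(\<Oplus>i\<in>{j..?N}. ?f i) = (\<Oplus>i\<in>{..?N}. ?f i)"
    proof (rule add.finprod_mono_neutral_cong_left)
      show "?f i = \<zero>" if "i \<in> {..?N} - {j..?N}" for i
        using that tc[of i] x s by (auto simp: not_le)
    qed (use f in auto)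
    also have "\<dots> = (\<Oplus>i\<in>{..?N}. t \<otimes> (c i \<otimes> (x \<otimes> s [^] i)))"
      using t cK x s by (intro finsum_cong') (auto simp: m_assoc)
    also have "\<dots> = t \<otimes> (\<Oplus>i\<in>{..?N}. c i \<otimes> (x \<otimes> s [^] i))"
      using t cK x s by (intro finsum_rdistr[symmetric]) auto
    also have "\<dots> = \<zero>" using rel[OF x] t by simp
    finally have z: "(\<Oplus>i\<in>{j..?N}. ?f i) = \<zero>" .
    have F: "(\<Oplus>i\<in>{j<..?N}. ?f i) \<in> carrier R" using f by (intro finsum_closed) auto
    have split: "{j..?N} = insert j {j<..?N}" using j(1) by auto
    have "(\<Oplus>i\<in>{j..?N}. ?f i) = ?f j \<oplus> (\<Oplus>i\<in>{j<..?N}. ?f i)"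
      unfolding split by (rule finsum_insert) (use f j(1) in auto)
    then have "?f j \<oplus> (\<Oplus>i\<in>{j<..?N}. ?f i) = \<zero>" by (simp only: z)
    then have "?f j = \<ominus> (\<Oplus>i\<in>{j<..?N}. ?f i)"
      using minus_equality[OF _ F f[OF j(1)]] by simp
    also have "(\<Oplus>i\<in>{j<..?N}. ?f i) = (\<Oplus>i\<in>{j<..?N}. t \<otimes> c i \<otimes> (x \<otimes> s [^] (i - Suc j + Suc j)))"
    proof (rule finsum_cong')
      fix i assume "i \<in> {j<..?N}"
      then have "i - Suc j + Suc j = i" by simp
      then show "?f i = t \<otimes> c i \<otimes> (x \<otimes> s [^] (i - Suc j + Suc j))" by (simp only:)
    next
      show "(\<lambda>i. t \<otimes> c i \<otimes> (x \<otimes> s [^] (i - Suc j + Suc j))) \<in> {j<..?N} \<rightarrow> carrier R"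
        using tcK x s by auto
    qed simp
    also have "\<ominus> \<dots> = \<psi> x \<otimes> s [^] Suc j" by (rule \<psi>_mult[OF x, symmetric])
    finally have fj: "?f j = \<psi> x \<otimes> s [^] Suc j" .
    have pow: "s [^] ?N = s [^] j \<otimes> s [^] (?N - j)"
      using nat_pow_mult[OF s, of j "?N - j"] le_add_diff_inverse[OF j(1)] by metis
    have pow_Suc: "s [^] Suc ?N = s [^] Suc j \<otimes> s [^] (?N - j)"
      using nat_pow_mult[OF s, of "Suc j" "?N - j"] le_add_diff_inverse[OF j(1)] add_Suc by metis
    have T: "t \<otimes> c j \<in> carrier R" using tcK[OF j(1)] by blast
    have "t \<otimes> c j \<otimes> x \<otimes> s [^] ?N = ?f j \<otimes> s [^] (?N - j)"
      unfolding pow by (rule regroup[OF T x]) (use s in auto)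
    also have "\<dots> = \<psi> x \<otimes> s [^] Suc ?N"
      unfolding fj pow_Suc using \<psi>_closed[OF x] s by (simp add: m_assoc)
    finally show ?thesis .
  qed
  moreover have "t \<otimes> c j \<in> K - P" using complement_mult[OF P t, of "c j"] j cK by blast
  ultimately show ?thesis by blast
qed

text \<open>The local identities are glued by the ideal \<open>J\<close> of all scalars for which one exists: by
  \<open>local_descent\<close> it lies in no prime, hence it contains \<open>1\<close>.\<close>
lemma strongly_pi_regular_elem_of_generated: "strongly_pi_regular_elem R s"
proof -
  let ?N = bound and ?K = "R\<lparr>carrier := K\<rparr>"
  interpret K: cring ?K by (rule K_cring)
  define J where "J = {k \<in> K. \<exists>\<psi>\<in>equivariant s.
    \<forall>x\<in>carrier R. k \<otimes> x \<otimes> s [^] ?N = \<psi> x \<otimes> s [^] Suc ?N}"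
  have JI: "k \<in> J" if "k \<in> K" "\<psi> \<in> equivariant s"
    "\<And>x. x \<in> carrier R \<Longrightarrow> k \<otimes> x \<otimes> s [^] ?N = \<psi> x \<otimes> s [^] Suc ?N" for k \<psi>
    unfolding J_def by (intro CollectI conjI bexI[of _ \<psi>] ballI that)
  have scale: "l \<otimes> k \<in> J" if k: "k \<in> J" and l: "l \<in> K" for k l
  proof -
    obtain \<psi> where \<psi>: "\<psi> \<in> equivariant s"
      and eq: "\<And>x. x \<in> carrier R \<Longrightarrow> k \<otimes> x \<otimes> s [^] ?N = \<psi> x \<otimes> s [^] Suc ?N"
      using k unfolding J_def by blast
    have kK: "k \<in> K" using k unfolding J_def by blast
    have c: "\<psi> x \<in> carrier R" if "x \<in> carrier R" for x
      by (rule equivariantD(1)[OF \<psi> that])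
    have "(\<lambda>x. l \<otimes> \<psi> x) \<in> equivariant s"
      by (rule equivariant_scale[OF \<psi> sub_carrier[OF l] s])
    moreover have "l \<otimes> k \<otimes> x \<otimes> s [^] ?N = l \<otimes> \<psi> x \<otimes> s [^] Suc ?N"
      if x: "x \<in> carrier R" for x
    proof -
      have "l \<otimes> k \<otimes> x \<otimes> s [^] ?N = l \<otimes> (k \<otimes> x \<otimes> s [^] ?N)"
        using l kK x s by (simp add: m_assoc)
      also have "\<dots> = l \<otimes> (\<psi> x \<otimes> s [^] Suc ?N)" by (simp only: eq[OF x])
      also have "\<dots> = l \<otimes> \<psi> x \<otimes> s [^] Suc ?N"
        by (rule m_assoc[symmetric, OF sub_carrier[OF l] c[OF x] nat_pow_closed[OF s]])
      finally show ?thesis .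
    qed
    ultimately show ?thesis by (rule JI[OF K_closed(4)[OF l kK]])
  qed
  have add: "k \<oplus> l \<in> J" if k: "k \<in> J" and l: "l \<in> J" for k l
  proof -
    obtain \<psi> where \<psi>: "\<psi> \<in> equivariant s"
      and eq: "\<And>x. x \<in> carrier R \<Longrightarrow> k \<otimes> x \<otimes> s [^] ?N = \<psi> x \<otimes> s [^] Suc ?N"
      using k unfolding J_def by blast
    obtain \<phi> where \<phi>: "\<phi> \<in> equivariant s"
      and eq': "\<And>x. x \<in> carrier R \<Longrightarrow> l \<otimes> x \<otimes> s [^] ?N = \<phi> x \<otimes> s [^] Suc ?N"
      using l unfolding J_def by blast
    have kl: "k \<in> K" "l \<in> K" using k l unfolding J_def by blast+
    have c: "\<psi> x \<in> carrier R" "\<phi> x \<in> carrier R" if "x \<in> carrier R" for x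
      by (rule equivariantD(1)[OF \<psi> that], rule equivariantD(1)[OF \<phi> that])
    have "(\<lambda>x. \<psi> x \<oplus> \<phi> x) \<in> equivariant s"
      by (rule equivariant_add[OF \<psi> \<phi> s])
    moreover have "(k \<oplus> l) \<otimes> x \<otimes> s [^] ?N = (\<psi> x \<oplus> \<phi> x) \<otimes> s [^] Suc ?N"
      if x: "x \<in> carrier R" for x
    proof -
      have "(k \<oplus> l) \<otimes> x \<otimes> s [^] ?N = k \<otimes> x \<otimes> s [^] ?N \<oplus> l \<otimes> x \<otimes> s [^] ?N"
        using kl x s by (simp add: l_distr)
      then show ?thesis unfolding eq[OF x] eq'[OF x] using c[OF x] s by (simp add: l_distr)
    qed
    ultimately show ?thesis by (rule JI[OF K_closed(5)[OF kl]])
  qed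
  have zero: "\<zero> \<in> J"
  proof -
    have "(\<lambda>x. \<zero>) \<in> equivariant s" using s by (simp add: equivariant_def)
    moreover have "\<zero> \<otimes> x \<otimes> s [^] ?N = \<zero> \<otimes> s [^] Suc ?N" if "x \<in> carrier R" for x
      using that s by simp
    ultimately show ?thesis by (rule JI[OF K_closed(1)])
  qed
  have J: "ideal J ?K"
  proof (rule idealI[OF K.ring_axioms])
    show "subgroup J (add_monoid ?K)"
    proof (rule subgroup.intro)
      fix k assume k: "k \<in> J"
      then have kK: "k \<in> carrier ?K" unfolding J_def by simp
      have "\<ominus>\<^bsub>?K\<^esub> k = (\<ominus>\<^bsub>?K\<^esub> \<one>\<^bsub>?K\<^esub>) \<otimes>\<^bsub>?K\<^esub> k" using K.l_minus[OF K.one_closed kK] K.l_one[OF kK] by simp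
      also have "\<dots> \<in> J" using scale[OF k, of "\<ominus>\<^bsub>?K\<^esub> \<one>\<^bsub>?K\<^esub>"] K.a_inv_closed[OF K.one_closed] by simp
      finally show "inv\<^bsub>add_monoid ?K\<^esub> k \<in> J" by (simp add: a_inv_def)
    next
      show "J \<subseteq> carrier (add_monoid ?K)" unfolding J_def by auto
    qed (simp_all add: add zero)
    fix a x assume ax: "a \<in> J" "x \<in> carrier ?K"
    then show "x \<otimes>\<^bsub>?K\<^esub> a \<in> J" using scale by simp
    moreover have "a \<in> K" using ax unfolding J_def by blast
    ultimately show "a \<otimes>\<^bsub>?K\<^esub> x \<in> J" using ax sub_m_comm[of a x] by simp
  qed
  have "\<one> \<in> J"
  proof (rule ccontr)
    assume one: "\<one> \<notin> J"
    obtain P where P: "primeideal P ?K" "J \<subseteq> P"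
      using K.prime_ideal_avoiding[OF J, of "{\<one>}"] one K_closed(2) by auto
    from local_descent[OF P(1)] obtain k where "k \<in> J" "k \<notin> P" unfolding J_def by blast
    with P(2) show False by blast
  qed
  then obtain \<psi> where \<psi>: "\<psi> \<in> equivariant s"
    and eq1: "\<And>x. x \<in> carrier R \<Longrightarrow> \<one> \<otimes> x \<otimes> s [^] ?N = \<psi> x \<otimes> s [^] Suc ?N"
    unfolding J_def by blast
  have eq: "x \<otimes> s [^] ?N = \<psi> x \<otimes> s [^] Suc ?N" if "x \<in> carrier R" for x
    using eq1[OF that] unfolding l_one[OF that] .
  show ?thesis
  proof (rule strongly_pi_regular_elemI[OF s])
    show "\<psi> \<one> \<in> carrier R" by (rule equivariantD(1)[OF \<psi> sub_carrier[OF K_closed(2)]])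
    show "s [^] ?N = \<psi> \<one> \<otimes> s [^] Suc ?N"
      using eq[OF sub_carrier[OF K_closed(2)]] unfolding l_one[OF nat_pow_closed[OF s]] .
    fix x assume x: "x \<in> carrier R" "x \<otimes> s [^] Suc ?N = \<zero>"
    have "x \<otimes> s [^] ?N = \<psi> (x \<otimes> s [^] Suc ?N)"
      unfolding equivariant_pow[OF \<psi> s x(1)] by (rule eq[OF x(1)])
    then show "x \<otimes> s [^] ?N = \<zero>" unfolding x(2) equivariantD(2)[OF \<psi>] .
  qed
qed

end

text \<open>Generators are given as an indexed family, since distinct indices may name the same
  generator; this happens for matrix units over the zero ring.\<close>
theorem strongly_pi_regular_if_finitely_generated:
  assumes "finite I" "g \<in> I \<rightarrow> carrier R"
    and "\<And>x. x \<in> carrier R \<Longrightarrow> \<exists>c\<in>I \<rightarrow> K. x = (\<Oplus>i\<in>I. c i \<otimes> g i)"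
  shows "strongly_pi_regular R"
  unfolding strongly_pi_regular_def
  using ring_axioms strongly_pi_regular_elem_of_generated[of I g] assms by blast

end

section \<open>Opposite rings and right modules\<close>

definition opposite :: "('a, 'm) ring_scheme \<Rightarrow> ('a, 'm) ring_scheme" where
  "opposite S = S\<lparr>mult := \<lambda>x y. y \<otimes>\<^bsub>S\<^esub> x\<rparr>"

lemma opposite_simps [simp]:
  "carrier (opposite S) = carrier S" "x \<otimes>\<^bsub>opposite S\<^esub> y = y \<otimes>\<^bsub>S\<^esub> x"
  "\<one>\<^bsub>opposite S\<^esub> = \<one>\<^bsub>S\<^esub>" "\<zero>\<^bsub>opposite S\<^esub> = \<zero>\<^bsub>S\<^esub>" "(\<oplus>\<^bsub>opposite S\<^esub>) = (\<oplus>\<^bsub>S\<^esub>)"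
  "finsum (opposite S) f A = finsum S f A"
  by (simp_all add: opposite_def finsum_def)

lemma (in ring) ring_opposite: "ring (opposite R)"
proof (rule ringI)
  show "abelian_group (opposite R)"
    using abelian_group_axioms by (simp add: abelian_group_def abelian_monoid_def abelian_group_axioms_def)
  show "monoid (opposite R)"
    by (rule monoidI) (auto simp: m_assoc)
qed (auto simp: l_distr r_distr)

lemma (in ring) pow_opposite:
  "x \<in> carrier R \<Longrightarrow> x [^]\<^bsub>opposite R\<^esub> (n::nat) = x [^] n"
  by (induction n) (simp_all flip: nat_pow_Suc2)

lemma (in ring) strongly_pi_regular_opposite:
  "strongly_pi_regular (opposite R) \<longleftrightarrow> strongly_pi_regular R"
  using ring_opposite ring_axioms
  by (auto simp: strongly_pi_regular_def strongly_pi_regular_elem_def pow_opposite)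

lemma (in regular_subcring) regular_subcring_opposite: "regular_subcring K (opposite R)"
proof -
  interpret op: ring "opposite R" by (rule ring_opposite)
  have "subcring K (opposite R)"
    using subcring_axioms unfolding subcring_def subring_def subcring_axioms_def submonoid_def
    by simp
  moreover have "\<exists>b\<in>K. a = a \<otimes>\<^bsub>opposite R\<^esub> a \<otimes>\<^bsub>opposite R\<^esub> b" if a: "a \<in> K" for a
  proof -
    obtain b where b: "b \<in> K" "a = a \<otimes> a \<otimes> b" using regular[OF a] by blast
    have "b \<otimes> (a \<otimes> a) = a \<otimes> a \<otimes> b" using sub_m_comm[OF b(1)] a K_closed(4) by simp
    then show ?thesis using b by (metis opposite_simps(2))
  qed
  ultimately show ?thesis
    by (intro regular_subcring.intro regular_subcring_axioms.intro op.ring_axioms)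
qed

theorem (in regular_subcring) strongly_pi_regular_finite_extension:
  assumes "finite_extension K R"
  shows "strongly_pi_regular R"
proof -
  obtain G where G: "finite G" "G \<subseteq> carrier R"
    and gen: "(\<forall>s\<in>carrier R. \<exists>c\<in>G \<rightarrow> K. s = (\<Oplus>g\<in>G. c g \<otimes> g)) \<or>
         (\<forall>s\<in>carrier R. \<exists>c\<in>G \<rightarrow> K. s = (\<Oplus>g\<in>G. g \<otimes> c g))"
    using assms by (auto simp: finite_extension_def)
  from gen show ?thesis
  proof
    assume "\<forall>s\<in>carrier R. \<exists>c\<in>G \<rightarrow> K. s = (\<Oplus>g\<in>G. c g \<otimes> g)"
    then show ?thesis
      using G by (intro strongly_pi_regular_if_finitely_generated[of G "\<lambda>g. g"]) auto
  next
    assume right: "\<forall>s\<in>carrier R. \<exists>c\<in>G \<rightarrow> K. s = (\<Oplus>g\<in>G. g \<otimes> c g)"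
    interpret op: regular_subcring K "opposite R" by (rule regular_subcring_opposite)
    have "strongly_pi_regular (opposite R)"
      using G right by (intro op.strongly_pi_regular_if_finitely_generated[of G "\<lambda>g. g"]) auto
    then show ?thesis by (simp add: strongly_pi_regular_opposite)
  qed
qed

section \<open>Matrix rings\<close>

text \<open>Curried presentation of matrices, on which the ring operations become operations on the entries.\<close>
definition matrix_of :: "nat \<Rightarrow> (nat \<Rightarrow> nat \<Rightarrow> 'a) \<Rightarrow> nat \<times> nat \<Rightarrow> 'a" where
  "matrix_of n f = (\<lambda>(i, j)\<in>{..<n} \<times> {..<n}. f i j)"

lemma matrix_of_nth [simp]: "i < n \<Longrightarrow> j < n \<Longrightarrow> matrix_of n f (i, j) = f i j"
  by (simp add: matrix_of_def)

lemma matrix_of_cong: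
  "(\<And>i j. i < n \<Longrightarrow> j < n \<Longrightarrow> f i j = g i j) \<Longrightarrow> matrix_of n f = matrix_of n g"
  by (auto simp: matrix_of_def fun_eq_iff restrict_def)

lemma matrix_of_in_carrier:
  "(\<And>i j. i < n \<Longrightarrow> j < n \<Longrightarrow> f i j \<in> carrier R) \<Longrightarrow> matrix_of n f \<in> carrier (matrix_ring n R)"
  by (auto simp: matrix_ring_def matrix_of_def)

lemma matrix_carrierE:
  assumes "A \<in> carrier (matrix_ring n R)"
  obtains f where "\<And>i j. i < n \<Longrightarrow> j < n \<Longrightarrow> f i j \<in> carrier R" "A = matrix_of n f"
proof (rule that[of "\<lambda>i j. A (i, j)"])
  show "A = matrix_of n (\<lambda>i j. A (i, j))"
    using assms by (auto simp: matrix_ring_def matrix_of_def fun_eq_iff PiE_iff extensional_def)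
qed (use assms in \<open>auto simp: matrix_ring_def PiE_iff\<close>)

context ring
begin

lemma matrix_add:
  "matrix_of n f \<oplus>\<^bsub>matrix_ring n R\<^esub> matrix_of n g = matrix_of n (\<lambda>i j. f i j \<oplus> g i j)"
  by (auto simp: matrix_ring_def matrix_of_def fun_eq_iff restrict_def)

lemma matrix_zero: "\<zero>\<^bsub>matrix_ring n R\<^esub> = matrix_of n (\<lambda>i j. \<zero>)"
  by (simp add: matrix_ring_def matrix_of_def)

lemma matrix_one: "\<one>\<^bsub>matrix_ring n R\<^esub> = matrix_of n (\<lambda>i j. if i = j then \<one> else \<zero>)"
  by (simp add: matrix_ring_def matrix_of_def)

lemma matrix_mult:
  assumes "\<And>i j. i < n \<Longrightarrow> j < n \<Longrightarrow> f i j \<in> carrier R" "\<And>i j. i < n \<Longrightarrow> j < n \<Longrightarrow> g i j \<in> carrier R"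
  shows "matrix_of n f \<otimes>\<^bsub>matrix_ring n R\<^esub> matrix_of n g
    = matrix_of n (\<lambda>i j. \<Oplus>k\<in>{..<n}. f i k \<otimes> g k j)"
proof -
  have "matrix_of n f \<otimes>\<^bsub>matrix_ring n R\<^esub> matrix_of n g
      = matrix_of n (\<lambda>i j. \<Oplus>k\<in>{..<n}. matrix_of n f (i, k) \<otimes> matrix_of n g (k, j))"
    by (simp add: matrix_ring_def matrix_of_def)
  also have "\<dots> = matrix_of n (\<lambda>i j. \<Oplus>k\<in>{..<n}. f i k \<otimes> g k j)"
    using assms by (intro matrix_of_cong finsum_cong') auto
  finally show ?thesis .
qed

lemma finsum_delta:
  assumes "i < (n::nat)" "a \<in> carrier R"
  shows "(\<Oplus>k\<in>{..<n}. if i = k then a else \<zero>) = a"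
  using finsum_singleton[of i "{..<n}" "\<lambda>_. a"] assms by simp

lemma diagonal_mult:
  assumes f: "\<And>i j. i < n \<Longrightarrow> j < n \<Longrightarrow> f i j \<in> carrier R" and a: "a \<in> carrier R"
  shows "matrix_of n (\<lambda>i j. if i = j then a else \<zero>) \<otimes>\<^bsub>matrix_ring n R\<^esub> matrix_of n f
    = matrix_of n (\<lambda>i j. a \<otimes> f i j)"
proof -
  have "matrix_of n (\<lambda>i j. if i = j then a else \<zero>) \<otimes>\<^bsub>matrix_ring n R\<^esub> matrix_of n f
      = matrix_of n (\<lambda>i j. \<Oplus>k\<in>{..<n}. (if i = k then a else \<zero>) \<otimes> f k j)"
    using f a by (intro matrix_mult) auto
  also have "\<dots> = matrix_of n (\<lambda>i j. a \<otimes> f i j)"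
  proof (rule matrix_of_cong)
    fix i j assume ij: "i < n" "j < n"
    have "(\<Oplus>k\<in>{..<n}. (if i = k then a else \<zero>) \<otimes> f k j)
        = (\<Oplus>k\<in>{..<n}. if i = k then a \<otimes> f i j else \<zero>)"
      using f a ij by (intro finsum_cong') auto
    then show "(\<Oplus>k\<in>{..<n}. (if i = k then a else \<zero>) \<otimes> f k j) = a \<otimes> f i j"
      using finsum_delta[OF ij(1), of "a \<otimes> f i j"] f ij a by simp
  qed
  finally show ?thesis .
qed

lemma mult_diagonal:
  assumes f: "\<And>i j. i < n \<Longrightarrow> j < n \<Longrightarrow> f i j \<in> carrier R" and a: "a \<in> carrier R"
  shows "matrix_of n f \<otimes>\<^bsub>matrix_ring n R\<^esub> matrix_of n (\<lambda>i j. if i = j then a else \<zero>)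
    = matrix_of n (\<lambda>i j. f i j \<otimes> a)"
proof -
  have "matrix_of n f \<otimes>\<^bsub>matrix_ring n R\<^esub> matrix_of n (\<lambda>i j. if i = j then a else \<zero>)
      = matrix_of n (\<lambda>i j. \<Oplus>k\<in>{..<n}. f i k \<otimes> (if k = j then a else \<zero>))"
    using f a by (intro matrix_mult) auto
  also have "\<dots> = matrix_of n (\<lambda>i j. f i j \<otimes> a)"
  proof (rule matrix_of_cong)
    fix i j assume ij: "i < n" "j < n"
    have "(\<Oplus>k\<in>{..<n}. f i k \<otimes> (if k = j then a else \<zero>))
        = (\<Oplus>k\<in>{..<n}. if j = k then f i j \<otimes> a else \<zero>)"
      using f a ij by (intro finsum_cong') auto
    then show "(\<Oplus>k\<in>{..<n}. f i k \<otimes> (if k = j then a else \<zero>)) = f i j \<otimes> a"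
      using finsum_delta[OF ij(2), of "f i j \<otimes> a"] f ij a by simp
  qed
  finally show ?thesis .
qed

lemma matrix_mult_assoc:
  assumes f: "\<And>i j. i < n \<Longrightarrow> j < n \<Longrightarrow> f i j \<in> carrier R"
    and g: "\<And>i j. i < n \<Longrightarrow> j < n \<Longrightarrow> g i j \<in> carrier R"
    and h: "\<And>i j. i < n \<Longrightarrow> j < n \<Longrightarrow> h i j \<in> carrier R"
  shows "matrix_of n f \<otimes>\<^bsub>matrix_ring n R\<^esub> matrix_of n g \<otimes>\<^bsub>matrix_ring n R\<^esub> matrix_of n h
    = matrix_of n f \<otimes>\<^bsub>matrix_ring n R\<^esub> (matrix_of n g \<otimes>\<^bsub>matrix_ring n R\<^esub> matrix_of n h)"
proof -
  have "matrix_of n f \<otimes>\<^bsub>matrix_ring n R\<^esub> matrix_of n g \<otimes>\<^bsub>matrix_ring n R\<^esub> matrix_of n h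
      = matrix_of n (\<lambda>i j. \<Oplus>k\<in>{..<n}. \<Oplus>l\<in>{..<n}. f i l \<otimes> g l k \<otimes> h k j)"
  proof (subst matrix_mult[OF f g], simp, simp, subst matrix_mult)
    show "matrix_of n (\<lambda>i j. \<Oplus>k\<in>{..<n}. (\<Oplus>l\<in>{..<n}. f i l \<otimes> g l k) \<otimes> h k j)
      = matrix_of n (\<lambda>i j. \<Oplus>k\<in>{..<n}. \<Oplus>l\<in>{..<n}. f i l \<otimes> g l k \<otimes> h k j)"
      using f g h by (intro matrix_of_cong finsum_cong' finsum_ldistr) (auto intro!: finsum_closed)
  qed (use f g h in \<open>auto intro!: finsum_closed\<close>)
  also have "\<dots> = matrix_of n (\<lambda>i j. \<Oplus>l\<in>{..<n}. \<Oplus>k\<in>{..<n}. f i l \<otimes> g l k \<otimes> h k j)"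
    using f g h by (intro matrix_of_cong finsum_swap) auto
  also have "\<dots> = matrix_of n (\<lambda>i j. \<Oplus>l\<in>{..<n}. f i l \<otimes> (\<Oplus>k\<in>{..<n}. g l k \<otimes> h k j))"
  proof (intro matrix_of_cong finsum_cong')
    fix i j l assume ijl: "i < n" "j < n" "l \<in> {..<n}"
    have "(\<Oplus>k\<in>{..<n}. f i l \<otimes> g l k \<otimes> h k j) = (\<Oplus>k\<in>{..<n}. f i l \<otimes> (g l k \<otimes> h k j))"
      using f g h ijl by (intro finsum_cong') (auto simp: m_assoc)
    also have "\<dots> = f i l \<otimes> (\<Oplus>k\<in>{..<n}. g l k \<otimes> h k j)"
      using f g h ijl by (intro finsum_rdistr[symmetric]) auto
    finally show "(\<Oplus>k\<in>{..<n}. f i l \<otimes> g l k \<otimes> h k j) = f i l \<otimes> (\<Oplus>k\<in>{..<n}. g l k \<otimes> h k j)" .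
  qed (use f g h in \<open>auto intro!: finsum_closed\<close>)
  also have "\<dots> = matrix_of n f \<otimes>\<^bsub>matrix_ring n R\<^esub> (matrix_of n g \<otimes>\<^bsub>matrix_ring n R\<^esub> matrix_of n h)"
    by (subst matrix_mult[OF g h], simp, simp, subst matrix_mult)
       (use f g h in \<open>auto intro!: finsum_closed\<close>)
  finally show ?thesis .
qed

lemma ring_matrix_ring: "ring (matrix_ring n R)"
proof (rule ringI)
  let ?M = "matrix_ring n R"
  show "abelian_group ?M"
  proof (rule abelian_groupI)
    fix A B C assume "A \<in> carrier ?M" "B \<in> carrier ?M" "C \<in> carrier ?M"
    then show "A \<oplus>\<^bsub>?M\<^esub> B \<oplus>\<^bsub>?M\<^esub> C = A \<oplus>\<^bsub>?M\<^esub> (B \<oplus>\<^bsub>?M\<^esub> C)"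
      by (elim matrix_carrierE) (auto simp: matrix_add a_assoc intro!: matrix_of_cong)
  next
    fix A B assume AB: "A \<in> carrier ?M" "B \<in> carrier ?M"
    then show "A \<oplus>\<^bsub>?M\<^esub> B \<in> carrier ?M"
      by (elim matrix_carrierE) (auto simp: matrix_add intro!: matrix_of_in_carrier)
    show "A \<oplus>\<^bsub>?M\<^esub> B = B \<oplus>\<^bsub>?M\<^esub> A"
      using AB by (elim matrix_carrierE) (auto simp: matrix_add a_comm intro!: matrix_of_cong)
  next
    fix A assume A: "A \<in> carrier ?M"
    then show "\<zero>\<^bsub>?M\<^esub> \<oplus>\<^bsub>?M\<^esub> A = A"
      by (elim matrix_carrierE) (auto simp: matrix_add matrix_zero intro!: matrix_of_cong)
    from A obtain f where f: "\<And>i j. i < n \<Longrightarrow> j < n \<Longrightarrow> f i j \<in> carrier R" "A = matrix_of n f"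
      by (metis matrix_carrierE)
    have "matrix_of n (\<lambda>i j. \<ominus> f i j) \<oplus>\<^bsub>?M\<^esub> A = \<zero>\<^bsub>?M\<^esub>"
      using f(1) by (auto simp: f(2) matrix_add matrix_zero l_neg intro!: matrix_of_cong)
    moreover have "matrix_of n (\<lambda>i j. \<ominus> f i j) \<in> carrier ?M"
      using f(1) by (intro matrix_of_in_carrier) auto
    ultimately show "\<exists>B\<in>carrier ?M. B \<oplus>\<^bsub>?M\<^esub> A = \<zero>\<^bsub>?M\<^esub>" by blast
  qed (auto simp: matrix_zero intro!: matrix_of_in_carrier)
  show "monoid ?M"
  proof (rule monoidI)
    fix A B C assume "A \<in> carrier ?M" "B \<in> carrier ?M" "C \<in> carrier ?M"
    then show "A \<otimes>\<^bsub>?M\<^esub> B \<otimes>\<^bsub>?M\<^esub> C = A \<otimes>\<^bsub>?M\<^esub> (B \<otimes>\<^bsub>?M\<^esub> C)"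
      by (elim matrix_carrierE) (simp add: matrix_mult_assoc)
  next
    fix A B assume AB: "A \<in> carrier ?M" "B \<in> carrier ?M"
    then show "A \<otimes>\<^bsub>?M\<^esub> B \<in> carrier ?M"
      by (elim matrix_carrierE) (auto simp: matrix_mult intro!: matrix_of_in_carrier finsum_closed)
  next
    fix A assume A: "A \<in> carrier ?M"
    then show "\<one>\<^bsub>?M\<^esub> \<otimes>\<^bsub>?M\<^esub> A = A"
      by (elim matrix_carrierE) (auto simp: matrix_one diagonal_mult intro!: matrix_of_cong)
    show "A \<otimes>\<^bsub>?M\<^esub> \<one>\<^bsub>?M\<^esub> = A"
      using A by (elim matrix_carrierE) (auto simp: matrix_one mult_diagonal intro!: matrix_of_cong)
  qed (auto simp: matrix_one intro!: matrix_of_in_carrier)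
next
  let ?M = "matrix_ring n R"
  fix A B C assume ABC: "A \<in> carrier ?M" "B \<in> carrier ?M" "C \<in> carrier ?M"
  obtain f g h where f: "\<And>i j. i < n \<Longrightarrow> j < n \<Longrightarrow> f i j \<in> carrier R" "A = matrix_of n f"
    and g: "\<And>i j. i < n \<Longrightarrow> j < n \<Longrightarrow> g i j \<in> carrier R" "B = matrix_of n g"
    and h: "\<And>i j. i < n \<Longrightarrow> j < n \<Longrightarrow> h i j \<in> carrier R" "C = matrix_of n h"
    using ABC by (metis matrix_carrierE)
  have "(A \<oplus>\<^bsub>?M\<^esub> B) \<otimes>\<^bsub>?M\<^esub> C = matrix_of n (\<lambda>i j. \<Oplus>k\<in>{..<n}. (f i k \<oplus> g i k) \<otimes> h k j)"
    unfolding f(2) g(2) h(2) matrix_add using f(1) g(1) h(1) by (intro matrix_mult) auto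
  also have "\<dots> = matrix_of n (\<lambda>i j. \<Oplus>k\<in>{..<n}. f i k \<otimes> h k j \<oplus> g i k \<otimes> h k j)"
    using f(1) g(1) h(1) by (intro matrix_of_cong finsum_cong') (auto simp: l_distr)
  also have "\<dots> = matrix_of n (\<lambda>i j. (\<Oplus>k\<in>{..<n}. f i k \<otimes> h k j) \<oplus> (\<Oplus>k\<in>{..<n}. g i k \<otimes> h k j))"
    using f(1) g(1) h(1) by (intro matrix_of_cong finsum_addf) auto
  also have "\<dots> = A \<otimes>\<^bsub>?M\<^esub> C \<oplus>\<^bsub>?M\<^esub> B \<otimes>\<^bsub>?M\<^esub> C"
    using f(1) g(1) h(1) by (simp add: f(2) g(2) h(2) matrix_mult matrix_add)
  finally show "(A \<oplus>\<^bsub>?M\<^esub> B) \<otimes>\<^bsub>?M\<^esub> C = A \<otimes>\<^bsub>?M\<^esub> C \<oplus>\<^bsub>?M\<^esub> B \<otimes>\<^bsub>?M\<^esub> C" .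
  have "C \<otimes>\<^bsub>?M\<^esub> (A \<oplus>\<^bsub>?M\<^esub> B) = matrix_of n (\<lambda>i j. \<Oplus>k\<in>{..<n}. h i k \<otimes> (f k j \<oplus> g k j))"
    unfolding f(2) g(2) h(2) matrix_add using f(1) g(1) h(1) by (intro matrix_mult) auto
  also have "\<dots> = matrix_of n (\<lambda>i j. \<Oplus>k\<in>{..<n}. h i k \<otimes> f k j \<oplus> h i k \<otimes> g k j)"
    using f(1) g(1) h(1) by (intro matrix_of_cong finsum_cong') (auto simp: r_distr)
  also have "\<dots> = matrix_of n (\<lambda>i j. (\<Oplus>k\<in>{..<n}. h i k \<otimes> f k j) \<oplus> (\<Oplus>k\<in>{..<n}. h i k \<otimes> g k j))"
    using f(1) g(1) h(1) by (intro matrix_of_cong finsum_addf) auto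
  also have "\<dots> = C \<otimes>\<^bsub>?M\<^esub> A \<oplus>\<^bsub>?M\<^esub> C \<otimes>\<^bsub>?M\<^esub> B"
    using f(1) g(1) h(1) by (simp add: f(2) g(2) h(2) matrix_mult matrix_add)
  finally show "C \<otimes>\<^bsub>?M\<^esub> (A \<oplus>\<^bsub>?M\<^esub> B) = C \<otimes>\<^bsub>?M\<^esub> A \<oplus>\<^bsub>?M\<^esub> C \<otimes>\<^bsub>?M\<^esub> B" .
qed

lemma matrix_finsum:
  assumes "finite I" "\<And>p i j. p \<in> I \<Longrightarrow> i < n \<Longrightarrow> j < n \<Longrightarrow> f p i j \<in> carrier R"
  shows "(\<Oplus>\<^bsub>matrix_ring n R\<^esub>p\<in>I. matrix_of n (f p)) = matrix_of n (\<lambda>i j. \<Oplus>p\<in>I. f p i j)"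
  using assms
proof (induction I rule: finite_induct)
  case empty
  interpret M: ring "matrix_ring n R" by (rule ring_matrix_ring)
  show ?case by (simp add: matrix_zero)
next
  case (insert a I)
  interpret M: ring "matrix_ring n R" by (rule ring_matrix_ring)
  have "(\<Oplus>\<^bsub>matrix_ring n R\<^esub>p\<in>insert a I. matrix_of n (f p))
      = matrix_of n (f a) \<oplus>\<^bsub>matrix_ring n R\<^esub> (\<Oplus>\<^bsub>matrix_ring n R\<^esub>p\<in>I. matrix_of n (f p))"
    using insert by (intro M.finsum_insert) (auto intro!: matrix_of_in_carrier)
  also have "\<dots> = matrix_of n (\<lambda>i j. f a i j \<oplus> (\<Oplus>p\<in>I. f p i j))"
    using insert by (simp add: matrix_add)
  also have "\<dots> = matrix_of n (\<lambda>i j. \<Oplus>p\<in>insert a I. f p i j)"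
    using insert by (intro matrix_of_cong finsum_insert[symmetric]) auto
  finally show ?case .
qed

end

theorem strongly_pi_regular_matrix_ring:
  assumes "cring R" and R: "strongly_regular R"
  shows "strongly_pi_regular (matrix_ring n R)"
proof -
  interpret R: cring R by fact
  let ?M = "matrix_ring n R"
  interpret M: ring ?M by (rule R.ring_matrix_ring)
  \<comment> \<open>Scalar matrices form a copy of \<open>R\<close> inside the matrix ring.\<close>
  define D where "D a = matrix_of n (\<lambda>i j. if i = j then a else \<zero>\<^bsub>R\<^esub>)" for a
  have D_closed: "D a \<in> carrier ?M" if "a \<in> carrier R" for a
    using that unfolding D_def by (intro matrix_of_in_carrier) auto
  have D_mult: "D a \<otimes>\<^bsub>?M\<^esub> D b = D (a \<otimes>\<^bsub>R\<^esub> b)" if "a \<in> carrier R" "b \<in> carrier R" for a b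
    unfolding D_def using that
    by (subst R.diagonal_mult) (auto intro!: matrix_of_cong)
  have D_add: "D a \<oplus>\<^bsub>?M\<^esub> D b = D (a \<oplus>\<^bsub>R\<^esub> b)" if "a \<in> carrier R" "b \<in> carrier R" for a b
    unfolding D_def R.matrix_add using that by (intro matrix_of_cong) auto
  have D_one: "D \<one>\<^bsub>R\<^esub> = \<one>\<^bsub>?M\<^esub>" by (simp add: D_def R.matrix_one)
  have D_minus: "\<ominus>\<^bsub>?M\<^esub> D a = D (\<ominus>\<^bsub>R\<^esub> a)" if a: "a \<in> carrier R" for a
  proof (rule M.minus_equality)
    have "D \<zero>\<^bsub>R\<^esub> = \<zero>\<^bsub>?M\<^esub>" by (simp add: D_def R.matrix_zero)
    then show "D (\<ominus>\<^bsub>R\<^esub> a) \<oplus>\<^bsub>?M\<^esub> D a = \<zero>\<^bsub>?M\<^esub>" using a by (simp add: D_add R.l_neg)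
  qed (use a D_closed in auto)
  let ?K = "D ` carrier R"
  have "subring ?K ?M"
  proof (rule M.subringI)
    show "\<one>\<^bsub>?M\<^esub> \<in> ?K" unfolding D_one[symmetric] by blast
  qed (auto simp: D_closed D_mult D_add D_minus)
  then have "subcring ?K ?M"
    by (rule M.subcringI) (auto simp: D_mult R.m_comm)
  moreover have "\<exists>y\<in>?K. x = x \<otimes>\<^bsub>?M\<^esub> x \<otimes>\<^bsub>?M\<^esub> y" if x: "x \<in> ?K" for x
  proof -
    obtain a where a: "a \<in> carrier R" "x = D a" using x by blast
    obtain b where b: "b \<in> carrier R" "a = a [^]\<^bsub>R\<^esub> (2::nat) \<otimes>\<^bsub>R\<^esub> b"
      using R a(1) unfolding strongly_regular_def by blast
    have "D a \<otimes>\<^bsub>?M\<^esub> D a \<otimes>\<^bsub>?M\<^esub> D b = D (a [^]\<^bsub>R\<^esub> (2::nat) \<otimes>\<^bsub>R\<^esub> b)"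
      using a(1) b(1) by (simp add: D_mult numeral_2_eq_2)
    also have "\<dots> = D a" by (simp only: b(2)[symmetric])
    finally show ?thesis using b(1) unfolding a(2) by (intro bexI[of _ "D b"]) auto
  qed
  ultimately interpret K: regular_subcring ?K ?M
    by (intro regular_subcring.intro regular_subcring_axioms.intro M.ring_axioms)
  \<comment> \<open>The matrix units; together with the diagonal matrices \<open>D a\<close> as coefficients they generate.\<close>
  define E where "E p = matrix_of n (\<lambda>i j. if p = (i, j) then \<one>\<^bsub>R\<^esub> else \<zero>\<^bsub>R\<^esub>)" for p
  let ?I = "{..<n} \<times> {..<n}"
  show ?thesis
  proof (rule K.strongly_pi_regular_if_finitely_generated)
    show "finite ?I" by simp
    show "E \<in> ?I \<rightarrow> carrier ?M" unfolding E_def by (auto intro!: matrix_of_in_carrier)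
    fix A assume A: "A \<in> carrier ?M"
    then obtain f where f: "\<And>i j. i < n \<Longrightarrow> j < n \<Longrightarrow> f i j \<in> carrier R" "A = matrix_of n f"
      by (metis matrix_carrierE)
    let ?c = "\<lambda>p. D (f (fst p) (snd p))"
    have "(\<Oplus>\<^bsub>?M\<^esub>p\<in>?I. ?c p \<otimes>\<^bsub>?M\<^esub> E p)
        = (\<Oplus>\<^bsub>?M\<^esub>p\<in>?I. matrix_of n (\<lambda>i j. if p = (i, j) then f i j else \<zero>\<^bsub>R\<^esub>))"
    proof (rule M.finsum_cong')
      fix p assume p: "p \<in> ?I"
      then have fp: "f (fst p) (snd p) \<in> carrier R" using f(1) by auto
      show "?c p \<otimes>\<^bsub>?M\<^esub> E p = matrix_of n (\<lambda>i j. if p = (i, j) then f i j else \<zero>\<^bsub>R\<^esub>)"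
        unfolding D_def E_def using fp
        by (subst R.diagonal_mult) (auto intro!: matrix_of_cong)
    qed (use f(1) in \<open>auto intro!: matrix_of_in_carrier\<close>)
    also have "\<dots> = matrix_of n (\<lambda>i j. \<Oplus>\<^bsub>R\<^esub>p\<in>?I. if p = (i, j) then f i j else \<zero>\<^bsub>R\<^esub>)"
      using f(1) by (intro R.matrix_finsum) auto
    also have "\<dots> = A"
      unfolding f(2)
    proof (rule matrix_of_cong)
      fix i j assume ij: "i < n" "j < n"
      have "(\<Oplus>\<^bsub>R\<^esub>p\<in>?I. if p = (i, j) then f i j else \<zero>\<^bsub>R\<^esub>)
          = (\<Oplus>\<^bsub>R\<^esub>p\<in>?I. if (i, j) = p then f i j else \<zero>\<^bsub>R\<^esub>)"
        using f(1) ij by (intro R.finsum_cong') auto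
      then show "(\<Oplus>\<^bsub>R\<^esub>p\<in>?I. if p = (i, j) then f i j else \<zero>\<^bsub>R\<^esub>) = f i j"
        using R.finsum_singleton[of "(i, j)" ?I "\<lambda>_. f i j"] f(1) ij by simp
    qed
    finally have "A = (\<Oplus>\<^bsub>?M\<^esub>p\<in>?I. ?c p \<otimes>\<^bsub>?M\<^esub> E p)" by simp
    moreover have "?c \<in> ?I \<rightarrow> ?K" using f(1) by auto
    ultimately show "\<exists>c\<in>?I \<rightarrow> ?K. A = (\<Oplus>\<^bsub>?M\<^esub>p\<in>?I. c p \<otimes>\<^bsub>?M\<^esub> E p)" by (rule bexI[of _ ?c])
  qed
qed

section \<open>Rings of continuous functions\<close>

lemma regular_subcring_iso_image:
  assumes "cring R" and R: "strongly_regular R" and "ring S" and K: "subring K S"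
    and iso: "R \<simeq> S\<lparr>carrier := K\<rparr>"
  shows "regular_subcring K S"
proof -
  interpret R: cring R by fact
  interpret S: ring S by fact
  obtain h where "h \<in> ring_iso R (S\<lparr>carrier := K\<rparr>)"
    using iso by (auto simp: is_ring_iso_def)
  then have h: "\<And>x. x \<in> carrier R \<Longrightarrow> h x \<in> K" "K = h ` carrier R"
    and mult: "\<And>x y. x \<in> carrier R \<Longrightarrow> y \<in> carrier R \<Longrightarrow> h (x \<otimes>\<^bsub>R\<^esub> y) = h x \<otimes>\<^bsub>S\<^esub> h y"
    by (auto simp: ring_iso_def ring_hom_def bij_betw_def)
  have "subcring K S"
  proof (rule S.subcringI[OF K])
    fix x y assume "x \<in> K" "y \<in> K"
    then obtain a b where "a \<in> carrier R" "b \<in> carrier R" "x = h a" "y = h b"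
      using h(2) by auto
    then show "x \<otimes>\<^bsub>S\<^esub> y = y \<otimes>\<^bsub>S\<^esub> x" using R.m_comm by (simp flip: mult)
  qed
  moreover have "\<exists>y\<in>K. x = x \<otimes>\<^bsub>S\<^esub> x \<otimes>\<^bsub>S\<^esub> y" if x: "x \<in> K" for x
  proof -
    obtain a where a: "a \<in> carrier R" "x = h a" using x h(2) by auto
    obtain b where b: "b \<in> carrier R" "a = a [^]\<^bsub>R\<^esub> (2::nat) \<otimes>\<^bsub>R\<^esub> b"
      using R a(1) unfolding strongly_regular_def by blast
    have "h a \<otimes>\<^bsub>S\<^esub> h a \<otimes>\<^bsub>S\<^esub> h b = h (a [^]\<^bsub>R\<^esub> (2::nat) \<otimes>\<^bsub>R\<^esub> b)"
      using a(1) b(1) by (simp add: mult numeral_2_eq_2)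
    also have "\<dots> = h a" by (simp only: b(2)[symmetric])
    finally show ?thesis using h(1)[OF b(1)] unfolding a(2) by (intro bexI[of _ "h b"]) auto
  qed
  ultimately show ?thesis
    by (intro regular_subcring.intro regular_subcring_axioms.intro S.ring_axioms)
qed

lemma C_ring_simps:
  "carrier (C_ring X) = {f \<in> extensional (topspace X). continuous_map X euclidean f}"
  "f \<otimes>\<^bsub>C_ring X\<^esub> g = (\<lambda>x\<in>topspace X. f x * g x)"
  "\<one>\<^bsub>C_ring X\<^esub> = (\<lambda>x\<in>topspace X. 1)"
  "\<zero>\<^bsub>C_ring X\<^esub> = (\<lambda>x\<in>topspace X. 0)"
  "f \<oplus>\<^bsub>C_ring X\<^esub> g = (\<lambda>x\<in>topspace X. f x + g x)"
  by (simp_all add: C_ring_def)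

lemma restrict_in_C_ring:
  "continuous_map X euclidean f \<Longrightarrow> restrict f (topspace X) \<in> carrier (C_ring X)"
  by (auto simp: C_ring_simps elim: continuous_map_eq)

lemma C_ring_continuous: "f \<in> carrier (C_ring X) \<Longrightarrow> continuous_map X euclidean f"
  by (simp add: C_ring_simps)

lemma C_ring_eqI:
  assumes "f \<in> carrier (C_ring X)" "g \<in> carrier (C_ring X)"
    and "\<And>x. x \<in> topspace X \<Longrightarrow> f x = g x"
  shows "f = g"
  using assms by (auto simp: C_ring_simps intro: extensionalityI)

lemma continuous_map_complex_mult:
  fixes f g :: "'a \<Rightarrow> complex"
  assumes "continuous_map X euclidean f" "continuous_map X euclidean g"
  shows "continuous_map X euclidean (\<lambda>x. f x * g x)"
  using assms by (simp add: continuous_map_atin tendsto_mult)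

lemma C_ring_closed:
  assumes "f \<in> carrier (C_ring X)" "g \<in> carrier (C_ring X)"
  shows "f \<oplus>\<^bsub>C_ring X\<^esub> g \<in> carrier (C_ring X)" "f \<otimes>\<^bsub>C_ring X\<^esub> g \<in> carrier (C_ring X)"
  unfolding C_ring_simps(2,5) using assms[THEN C_ring_continuous]
  by (simp_all add: restrict_in_C_ring continuous_map_add continuous_map_complex_mult)

lemma cring_C_ring: "cring (C_ring X)"
proof (rule cringI)
  let ?C = "C_ring X"
  have zero: "\<zero>\<^bsub>?C\<^esub> \<in> carrier ?C" and one: "\<one>\<^bsub>?C\<^esub> \<in> carrier ?C"
    unfolding C_ring_simps(3,4) by (auto intro: restrict_in_C_ring)
  show "abelian_group ?C"
  proof (rule abelian_groupI)
    fix f assume f: "f \<in> carrier ?C"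
    let ?g = "\<lambda>x\<in>topspace X. - f x"
    have "?g \<in> carrier ?C"
      using f by (intro restrict_in_C_ring continuous_map_minus C_ring_continuous)
    moreover have "?g \<oplus>\<^bsub>?C\<^esub> f = \<zero>\<^bsub>?C\<^esub>" by (auto simp: C_ring_simps)
    ultimately show "\<exists>g\<in>carrier ?C. g \<oplus>\<^bsub>?C\<^esub> f = \<zero>\<^bsub>?C\<^esub>" by blast
    show "\<zero>\<^bsub>?C\<^esub> \<oplus>\<^bsub>?C\<^esub> f = f"
      by (rule C_ring_eqI[OF C_ring_closed(1)[OF zero f] f]) (simp add: C_ring_simps)
  qed (use zero C_ring_closed in \<open>auto simp: C_ring_simps(5) fun_eq_iff\<close>)
  show "comm_monoid ?C"
  proof (rule comm_monoidI)
    fix f assume f: "f \<in> carrier ?C"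
    show "\<one>\<^bsub>?C\<^esub> \<otimes>\<^bsub>?C\<^esub> f = f"
      by (rule C_ring_eqI[OF C_ring_closed(2)[OF one f] f]) (simp add: C_ring_simps)
  qed (use one C_ring_closed in \<open>auto simp: C_ring_simps(2) fun_eq_iff mult.assoc mult.commute\<close>)
qed (auto simp: C_ring_simps(2,5) fun_eq_iff distrib_right)

text \<open>A ring of functions with values in a field has no nonzero nilpotents, and the primes are maximal by the
  definition of a P-space.\<close>
lemma strongly_regular_C_ring:
  assumes "P_space_rel_C X"
  shows "strongly_regular (C_ring X)"
proof (rule cring.strongly_regular_if_primes_maximal[OF cring_C_ring])
  fix f assume f: "f \<in> carrier (C_ring X)" and ff: "f \<otimes>\<^bsub>C_ring X\<^esub> f = \<zero>\<^bsub>C_ring X\<^esub>"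
  interpret C: cring "C_ring X" by (rule cring_C_ring)
  show "f = \<zero>\<^bsub>C_ring X\<^esub>"
  proof (rule C_ring_eqI[OF f C.zero_closed])
    fix x assume "x \<in> topspace X"
    then show "f x = \<zero>\<^bsub>C_ring X\<^esub> x"
      using fun_cong[OF ff, of x] by (simp add: C_ring_simps)
  qed
qed (use assms in \<open>auto simp: P_space_rel_C_def\<close>)

theorem theorem29:
  fixes X :: "'a topology"
  assumes "Hausdorff_space X"
    and "P_space_rel_C X"
  shows "strongly_regular (C_ring X) \<and>
    (\<forall>(S :: ('b, 'm) ring_scheme) K.
        finite_extension K S \<and> C_ring X \<simeq> S\<lparr>carrier := K\<rparr> \<longrightarrow> strongly_pi_regular S) \<and>
    (\<forall>n::nat. n \<ge> 1 \<longrightarrow> strongly_pi_regular (matrix_ring n (C_ring X)))"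
proof -
  have regular: "strongly_regular (C_ring X)" using assms(2) by (rule strongly_regular_C_ring)
  have "strongly_pi_regular S"
    if fin: "finite_extension K S" and iso: "C_ring X \<simeq> S\<lparr>carrier := K\<rparr>"
    for S :: "('b, 'm) ring_scheme" and K
  proof -
    have "ring S" "subring K S" using fin by (simp_all add: finite_extension_def)
    then interpret regular_subcring K S
      using regular_subcring_iso_image[OF cring_C_ring regular _ _ iso] by blast
    show ?thesis by (rule strongly_pi_regular_finite_extension[OF fin])
  qed
  then show ?thesis
    using regular strongly_pi_regular_matrix_ring[OF cring_C_ring regular] by blast
qed

end
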